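(* Let $\mathcal{R}$ be a commutative ring with unit, let $\mathcal{C}$ be a finite abstract simplicial complex, let $\mathcal{V}=\{V_0,\ldots,V_n\}$ be a partition of $V(\mathcal{C})$, and let $m\ge0$ be an integer. If $\widetilde H_{|I|+m-2}(\mathcal{C}[V_I];\mathcal{R})=0$ for all nonempty $I\subseteq\{0,1,\ldots,n\}$, where $V_I=\bigcup_{i\in I}V_i$, then $\widetilde H_{m-1}(\mathbf{Col}(\mathcal{C},\mathcal{V});\mathcal{R})=0$.
   Context: $\mathcal{C}[X]=\{\sigma\in\mathcal{C}:\sigma\subseteq X\}$. $\widetilde H_j$ denotes reduced simplicial homology (with $\widetilde H_{-1}(\mathcal{K})=0$ iff $\mathcal{K}$ has at least one vertex). The colorful complex $\mathbf{Col}(\mathcal{C},\mathcal{V})$ is the simplicial complex whose vertices are the simplices $\sigma\in\mathcal{C}$ containing at least one vertex of every class $V_i$, and whose simplices are the sets $\{\sigma_1,\ldots,\sigma_\ell\}$ of such simplices with $\sigma_1\subset\cdots\subset\sigma_\ell$. *)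

theory Defs
  imports Main
begin

definition simplicial_complex :: "'a set set \<Rightarrow> bool" where
  "simplicial_complex K \<longleftrightarrow> (\<forall>\<sigma>\<in>K. finite \<sigma>) \<and> (\<forall>\<sigma>\<in>K. \<forall>\<tau>. \<tau> \<subseteq> \<sigma> \<longrightarrow> \<tau> \<in> K)"

definition vertices :: "'a set set \<Rightarrow> 'a set" where
  "vertices K = \<Union>K"

definition induced :: "'a set set \<Rightarrow> 'a set \<Rightarrow> 'a set set" where
  "induced K X = {\<sigma>\<in>K. \<sigma> \<subseteq> X}"

definition colorful_simplices :: "'a set set \<Rightarrow> (nat \<Rightarrow> 'a set) \<Rightarrow> nat \<Rightarrow> 'a set set" where
  "colorful_simplices K V n = {\<sigma>\<in>K. \<forall>i\<le>n. \<sigma> \<inter> V i \<noteq> {}}"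

definition Col :: "'a set set \<Rightarrow> (nat \<Rightarrow> 'a set) \<Rightarrow> nat \<Rightarrow> 'a set set set" where
  "Col K V n = {S. finite S \<and> S \<subseteq> colorful_simplices K V n \<and>
                   (\<forall>a\<in>S. \<forall>b\<in>S. a \<subseteq> b \<or> b \<subseteq> a)}"

text \<open>A fixed (arbitrary) well-order on the vertex type, used only to orient simplices.\<close>
definition vord :: "'a rel" where
  "vord = (SOME r. Well_order r \<and> Field r = UNIV)"

text \<open>Simplices of dimension j of K, where the empty simplex is always present in
dimension -1 (augmented chain complex).\<close>
definition simplices_of :: "'a set set \<Rightarrow> int \<Rightarrow> 'a set set" where
  "simplices_of K j = {\<sigma>\<in>K \<union> {{}}. finite \<sigma> \<and> int (card \<sigma>) = j + 1}"

definition chains :: "'r itself \<Rightarrow> 'a set set \<Rightarrow> int \<Rightarrow> ('a set \<Rightarrow> 'r::comm_ring_1) set" where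
  "chains _ K j = {c. \<forall>\<sigma>. \<sigma> \<notin> simplices_of K j \<longrightarrow> c \<sigma> = 0}"

definition face_sign :: "'a set \<Rightarrow> 'a \<Rightarrow> 'r::comm_ring_1" where
  "face_sign \<sigma> v = (-1) ^ card {u\<in>\<sigma>. (u, v) \<in> vord \<and> u \<noteq> v}"

definition bd :: "'a set set \<Rightarrow> int \<Rightarrow> ('a set \<Rightarrow> 'r::comm_ring_1) \<Rightarrow> ('a set \<Rightarrow> 'r)" where
  "bd K j c = (\<lambda>\<tau>. if \<tau> \<in> simplices_of K (j - 1)
       then (\<Sum>v\<in>{v. v \<notin> \<tau> \<and> insert v \<tau> \<in> simplices_of K j}.
               face_sign (insert v \<tau>) v * c (insert v \<tau>))
       else 0)"

definition reduced_homology_vanishes :: "'r::comm_ring_1 itself \<Rightarrow> 'a set set \<Rightarrow> int \<Rightarrow> bool" where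
  "reduced_homology_vanishes R K j \<longleftrightarrow>
     (\<forall>c \<in> chains R K j. bd K j c = (\<lambda>_. 0) \<longrightarrow>
        (\<exists>d \<in> chains R K (j + 1). bd K (j + 1) d = c))"

end

theory Submission
  imports Defs "HOL-Library.Disjoint_Sets"
begin

text \<open>Call a simplex colorful if it meets every class. Up to a shift of degree by \<open>n\<close>, the chains
of \<open>C\<close> modulo the non-colorful simplices compute the homology of the complex of products
\<open>(\<sigma> \<inter> V\<^sub>0) \<times> \<dots> \<times> (\<sigma> \<inter> V\<^sub>n)\<close> of simplices, of which \<open>Col\<close> is the barycentric subdivision.
Killing the simplices that miss one color at a time, a long exact sequence argument derives the
vanishing of this relative homology from the hypotheses on the \<open>C[V\<^sub>I]\<close>. The reduced
version of the relative complex needs an augmentation on simplices with one vertex per color: it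
sends \<open>[v\<^sub>0, \<dots>, v\<^sub>n]\<close> to \<open>\<plusminus>1\<close>, and arises by iterating the connecting map.

The result is transported to \<open>Col\<close> by two chain maps: the subdivision, defined by coning, and a map in
the other direction carried by \<open>s \<mapsto> \<Union>s\<close>, the largest element of the chain \<open>s\<close>. The latter
exists because the vanishing result also applies to a single colorful simplex. Coning with
\<open>\<Union>s\<close> yields a homotopy from the identity of \<open>Col\<close> to their composition.\<close>

section \<open>Simplicial chains\<close>

definition supported_on :: "'b set \<Rightarrow> ('b \<Rightarrow> 'r::zero) \<Rightarrow> bool" where
  "supported_on S c \<longleftrightarrow> (\<forall>x. x \<notin> S \<longrightarrow> c x = 0)"

text \<open>Chains are functions on all sets, of mixed degree, and degrees are measured by cardinality,
so that the empty simplex has degree 0. For chains supported on a complex with finite vertex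
set \<open>U\<close> this is the boundary map of that complex.\<close>
definition boundary :: "'b set \<Rightarrow> ('b set \<Rightarrow> 'r::comm_ring_1) \<Rightarrow> 'b set \<Rightarrow> 'r" where
  "boundary U c \<tau> =
     (if \<tau> \<subseteq> U then \<Sum>v\<in>U - \<tau>. face_sign (insert v \<tau>) v * c (insert v \<tau>) else 0)"

text \<open>The join with \<open>a\<close>. Coefficients of \<open>c\<close> on simplices that
  already contain \<open>a\<close> are discarded, since that join is degenerate. With this sign,
  deleting \<open>a\<close> again returns \<open>c\<close> with coefficient 1.\<close>

definition cone :: "'b \<Rightarrow> ('b set \<Rightarrow> 'r::comm_ring_1) \<Rightarrow> 'b set \<Rightarrow> 'r" where
  "cone a c \<sigma> = (if a \<in> \<sigma> then face_sign \<sigma> a * c (\<sigma> - {a}) else 0)"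

definition single :: "'b \<Rightarrow> 'b \<Rightarrow> 'r::comm_ring_1" where
  "single a = (\<lambda>x. if x = a then 1 else 0)"

text \<open>Coefficients of \<open>c\<close> outside \<open>A\<close> are ignored. When
  \<open>A\<close> is the set of colorful simplices, the map therefore factors through the chains
  modulo non-colorful simplices.\<close>

definition lin_ext :: "'b set \<Rightarrow> ('b \<Rightarrow> 'c \<Rightarrow> 'r) \<Rightarrow> ('b \<Rightarrow> 'r) \<Rightarrow> 'c \<Rightarrow> 'r::comm_ring_1" where
  "lin_ext A f c = (\<lambda>x. \<Sum>a\<in>A. c a * f a x)"

text \<open>As \<open>k\<close> is a cardinality, this is vanishing of reduced homology in degree
  \<open>k - 1\<close>. The vertex set \<open>U\<close> is separate from \<open>K\<close> so that
  all induced subcomplexes share one boundary map.\<close>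

definition exact_at :: "'r::comm_ring_1 itself \<Rightarrow> 'b set \<Rightarrow> 'b set set \<Rightarrow> nat \<Rightarrow> bool" where
  "exact_at R U K k \<longleftrightarrow>
     (\<forall>c :: 'b set \<Rightarrow> 'r.
        supported_on {\<sigma>\<in>K. card \<sigma> = k} c \<longrightarrow> boundary U c = (\<lambda>_. 0) \<longrightarrow>
        (\<exists>d. supported_on {\<sigma>\<in>K. card \<sigma> = Suc k} d \<and> boundary U d = c))"

lemma supported_onD: "supported_on S c \<Longrightarrow> c x \<noteq> 0 \<Longrightarrow> x \<in> S"
  by (auto simp: supported_on_def)

lemma supported_onI: "(\<And>x. c x \<noteq> 0 \<Longrightarrow> x \<in> S) \<Longrightarrow> supported_on S c"
  by (auto simp: supported_on_def)

lemma supported_on_mono: "supported_on S c \<Longrightarrow> S \<subseteq> T \<Longrightarrow> supported_on T c"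
  by (auto simp: supported_on_def)

lemma supported_on_diff:
  fixes c d :: "'b \<Rightarrow> 'r::group_add"
  shows "supported_on S c \<Longrightarrow> supported_on S d \<Longrightarrow> supported_on S (\<lambda>x. c x - d x)"
  by (auto simp: supported_on_def)

lemma supported_on_add:
  fixes c d :: "'b \<Rightarrow> 'r::monoid_add"
  shows "supported_on S c \<Longrightarrow> supported_on S d \<Longrightarrow> supported_on S (\<lambda>x. c x + d x)"
  by (auto simp: supported_on_def)

lemma supported_on_single: "supported_on {a} (single a)"
  by (auto simp: supported_on_def single_def)

lemma supported_on_lin_ext:
  assumes "\<And>a. a \<in> A \<Longrightarrow> c a \<noteq> 0 \<Longrightarrow> supported_on S (f a)"
  shows "supported_on S (lin_ext A f c)"
  unfolding supported_on_def lin_ext_def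
proof (intro allI impI sum.neutral ballI)
  fix x a assume "x \<notin> S" "a \<in> A"
  then show "c a * f a x = 0" using assms[of a] by (cases "c a = 0") (auto simp: supported_on_def)
qed

lemma lin_ext_by_singles:
  assumes "finite A" "supported_on A c" shows "lin_ext A single c = c"
proof
  fix x
  have "(\<Sum>b\<in>A. c b * single b x) = (\<Sum>b\<in>A. if b = x then c b else 0)"
    by (rule sum.cong) (auto simp: single_def)
  then show "lin_ext A single c x = c x"
    using assms by (auto simp add: lin_ext_def supported_on_def)
qed

lemma lin_ext_zero: "lin_ext A f (\<lambda>_. 0) = (\<lambda>_. 0)"
  by (simp add: lin_ext_def)

lemma lin_ext_lin_ext: "lin_ext B f (lin_ext A g c) = lin_ext A (\<lambda>a. lin_ext B f (g a)) c"
proof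
  fix x
  have "(\<Sum>b\<in>B. (\<Sum>a\<in>A. c a * g a b) * f b x) = (\<Sum>b\<in>B. \<Sum>a\<in>A. c a * (g a b * f b x))"
    by (simp add: sum_distrib_right mult.assoc)
  also have "\<dots> = (\<Sum>a\<in>A. \<Sum>b\<in>B. c a * (g a b * f b x))" by (rule sum.swap)
  finally show "lin_ext B f (lin_ext A g c) x = lin_ext A (\<lambda>a. lin_ext B f (g a)) c x"
    by (simp add: lin_ext_def sum_distrib_left)
qed

lemma lin_ext_cong:
  assumes "\<And>a. a \<in> A \<Longrightarrow> c a \<noteq> 0 \<Longrightarrow> f a x = g a x"
  shows "lin_ext A f c x = lin_ext A g c x"
  unfolding lin_ext_def
proof (rule sum.cong)
  fix a assume "a \<in> A"
  then show "c a * f a x = c a * g a x" using assms[of a] by (cases "c a = 0") auto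
qed simp

lemma boundary_lin_ext: "boundary U (lin_ext A f c) = lin_ext A (\<lambda>a. boundary U (f a)) c"
proof
  fix \<tau>
  have "(\<Sum>v\<in>U-\<tau>. face_sign (insert v \<tau>) v * (\<Sum>a\<in>A. c a * f a (insert v \<tau>)))
      = (\<Sum>v\<in>U-\<tau>. \<Sum>a\<in>A. c a * (face_sign (insert v \<tau>) v * f a (insert v \<tau>)))"
    by (simp add: sum_distrib_left mult_ac)
  also have "\<dots> = (\<Sum>a\<in>A. \<Sum>v\<in>U-\<tau>. c a * (face_sign (insert v \<tau>) v * f a (insert v \<tau>)))"
    by (rule sum.swap)
  finally show "boundary U (lin_ext A f c) \<tau> = lin_ext A (\<lambda>a. boundary U (f a)) c \<tau>"
    by (simp add: boundary_def lin_ext_def sum_distrib_left)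
qed

lemma boundary_diff: "boundary U (\<lambda>x. c x - d x) = (\<lambda>x. boundary U c x - boundary U d x)"
  by (auto simp: boundary_def right_diff_distrib sum_subtractf)

lemma boundary_add: "boundary U (\<lambda>x. c x + d x) = (\<lambda>x. boundary U c x + boundary U d x)"
  by (auto simp: boundary_def distrib_left sum.distrib)

lemma boundary_scale: "boundary U (\<lambda>x. a * c x) = (\<lambda>x. a * boundary U c x)"
  by (auto simp: boundary_def sum_distrib_left mult_ac)

lemma boundary_zero: "boundary U (\<lambda>_. 0) = (\<lambda>_. 0)"
  by (auto simp: boundary_def)

lemma boundary_nonzeroE:
  assumes "boundary U c \<tau> \<noteq> 0"
  obtains v where "\<tau> \<subseteq> U" "v \<in> U" "v \<notin> \<tau>" "c (insert v \<tau>) \<noteq> 0"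
proof -
  have "\<tau> \<subseteq> U" using assms by (auto simp: boundary_def split: if_splits)
  with assms have "(\<Sum>v\<in>U-\<tau>. face_sign (insert v \<tau>) v * c (insert v \<tau>)) \<noteq> 0"
    by (auto simp: boundary_def)
  then obtain v where "v \<in> U - \<tau>" "face_sign (insert v \<tau>) v * c (insert v \<tau>) \<noteq> 0"
    by (meson sum.neutral)
  with \<open>\<tau> \<subseteq> U\<close> that show thesis by fastforce
qed

lemma supported_on_boundary:
  assumes "finite U" "supported_on {\<sigma>\<in>K. card \<sigma> = Suc k} c"
    and "\<And>\<sigma> v. \<sigma> \<in> K \<Longrightarrow> \<sigma> - {v} \<in> K"
  shows "supported_on {\<sigma>\<in>K. card \<sigma> = k} (boundary U c)"
proof (rule supported_onI)
  fix \<tau> assume "boundary U c \<tau> \<noteq> 0"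
  then obtain v where v: "\<tau> \<subseteq> U" "v \<notin> \<tau>" "c (insert v \<tau>) \<noteq> 0" by (rule boundary_nonzeroE)
  have "insert v \<tau> \<in> K" "card (insert v \<tau>) = Suc k" using supported_onD[OF assms(2) v(3)] by auto
  moreover have "finite \<tau>" using v(1) assms(1) finite_subset by blast
  ultimately show "\<tau> \<in> {\<sigma>\<in>K. card \<sigma> = k}" using assms(3)[of "insert v \<tau>" v] v(2) by auto
qed

section \<open>Orientation signs, the squared boundary and cones\<close>

lemma vord: "Well_order (vord :: 'a rel)" "Field (vord :: 'a rel) = UNIV"
proof -
  have "Well_order (vord :: 'a rel) \<and> Field (vord :: 'a rel) = UNIV"
    unfolding vord_def by (rule someI_ex) (rule well_ordering)
  then show "Well_order (vord :: 'a rel)" "Field (vord :: 'a rel) = UNIV" by auto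
qed

lemma vord_antisym: "(x, y) \<in> vord \<Longrightarrow> (y, x) \<in> vord \<Longrightarrow> x = y"
  using vord(1)[where ?'a='a]
  by (auto simp: well_order_on_def linear_order_on_def partial_order_on_def dest: antisymD)

lemma vord_total: "x \<noteq> y \<Longrightarrow> (x, y) \<in> vord \<or> (y, x) \<in> (vord :: 'a rel)"
  using vord[where ?'a='a]
  by (auto simp: well_order_on_def linear_order_on_def total_on_def)

lemma face_sign_square: "face_sign \<sigma> v * face_sign \<sigma> v = (1 :: 'r::comm_ring_1)"
  by (simp add: face_sign_def flip: power_mult_distrib)

lemma face_sign_insert:
  assumes "finite \<tau>" "a \<noteq> v" "a \<notin> \<tau>"
  shows "face_sign (insert a \<tau>) v =
    (if (a, v) \<in> vord then - face_sign \<tau> v else face_sign \<tau> v :: 'r::comm_ring_1)"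
proof (cases "(a, v) \<in> vord")
  case True
  then have "{u \<in> insert a \<tau>. (u, v) \<in> vord \<and> u \<noteq> v} = insert a {u \<in> \<tau>. (u, v) \<in> vord \<and> u \<noteq> v}"
    using assms by auto
  with True assms show ?thesis by (simp add: face_sign_def)
next
  case False
  then have "{u \<in> insert a \<tau>. (u, v) \<in> vord \<and> u \<noteq> v} = {u \<in> \<tau>. (u, v) \<in> vord \<and> u \<noteq> v}"
    by auto
  with False show ?thesis by (simp add: face_sign_def)
qed

text \<open>Exactly one of \<open>a\<close> and \<open>v\<close> precedes the other, so exactly one
  of the two signs changes when the other vertex is added. The vanishing of the squared boundary and
  the cone formula both rest on this.\<close>

lemma face_sign_swap:
  assumes "finite \<tau>" "a \<noteq> v" "a \<notin> \<tau>" "v \<notin> \<tau>"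
  shows "face_sign (insert a (insert v \<tau>)) v * face_sign (insert a \<tau>) a =
    - (face_sign (insert a (insert v \<tau>)) a * face_sign (insert v \<tau>) v :: 'r::comm_ring_1)"
proof -
  have 1: "face_sign (insert a (insert v \<tau>)) v =
      (if (a, v) \<in> vord then - face_sign (insert v \<tau>) v else face_sign (insert v \<tau>) v :: 'r)"
    using assms by (intro face_sign_insert) auto
  have 2: "face_sign (insert a (insert v \<tau>)) a =
      (if (v, a) \<in> vord then - face_sign (insert a \<tau>) a else face_sign (insert a \<tau>) a :: 'r)"
    using assms by (subst insert_commute, intro face_sign_insert) auto
  show ?thesis
  proof (cases "(a, v) \<in> vord")
    case True
    then have "(v, a) \<notin> vord" using vord_antisym[of a v] assms(2) by blast
    with True show ?thesis unfolding 1 2 by (simp add: mult.commute)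
  next
    case False
    then have "(v, a) \<in> vord" using vord_total[OF assms(2)] by blast
    with False show ?thesis unfolding 1 2 by (simp add: mult.commute)
  qed
qed

text \<open>Exchanging the summations would only show that the sum equals its own negative, which is
  not enough in a ring where 2 is a zero divisor. The induction cancels each pair of terms
  separately.\<close>

lemma sum_antisymmetric:
  fixes g :: "'b \<Rightarrow> 'b \<Rightarrow> 'r::ab_group_add"
  assumes "finite A" "\<And>v w. v \<in> A \<Longrightarrow> w \<in> A \<Longrightarrow> v \<noteq> w \<Longrightarrow> g v w = - g w v"
  shows "(\<Sum>v\<in>A. \<Sum>w\<in>A - {v}. g v w) = 0"
  using assms
proof (induction A)
  case (insert a A)
  have "(\<Sum>w\<in>insert a A - {v}. g v w) = g v a + (\<Sum>w\<in>A - {v}. g v w)" if "v \<in> A" for v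
  proof -
    have "insert a A - {v} = insert a (A - {v})" using that insert.hyps by auto
    then show ?thesis using insert.hyps by simp
  qed
  then have "(\<Sum>v\<in>A. \<Sum>w\<in>insert a A - {v}. g v w) = (\<Sum>v\<in>A. g v a) + (\<Sum>v\<in>A. \<Sum>w\<in>A - {v}. g v w)"
    by (simp add: sum.distrib)
  also have "(\<Sum>v\<in>A. g v a) = (\<Sum>v\<in>A. - g a v)"
    by (rule sum.cong[OF refl], rule insert.prems(1)) (use insert.hyps in auto)
  finally have "(\<Sum>v\<in>A. \<Sum>w\<in>insert a A - {v}. g v w) =
      - (\<Sum>v\<in>A. g a v) + (\<Sum>v\<in>A. \<Sum>w\<in>A - {v}. g v w)" by (simp add: sum_negf)
  moreover have "(\<Sum>v\<in>A. \<Sum>w\<in>A - {v}. g v w) = 0"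
    by (rule insert.IH) (rule insert.prems(1), auto)
  moreover have "insert a A - {a} = A" using insert.hyps by auto
  ultimately show ?case using insert.hyps by simp
qed simp

lemma boundary_boundary:
  fixes c :: "'b set \<Rightarrow> 'r::comm_ring_1"
  assumes "finite U" shows "boundary U (boundary U c) = (\<lambda>_. 0)"
proof
  fix \<tau>
  show "boundary U (boundary U c) \<tau> = 0"
  proof (cases "\<tau> \<subseteq> U")
    case True
    then have "finite \<tau>" using assms finite_subset by blast
    define g where "g v w = face_sign (insert v \<tau>) v *
      (face_sign (insert w (insert v \<tau>)) w * c (insert w (insert v \<tau>)))" for v w
    have "boundary U (boundary U c) \<tau> = (\<Sum>v\<in>U-\<tau>. \<Sum>w\<in>(U-\<tau>) - {v}. g v w)"
    proof -
      have "U - \<tau> - {v} = U - insert v \<tau>" for v by auto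
      then show ?thesis
        using True by (auto simp: boundary_def g_def sum_distrib_left intro!: sum.cong)
    qed
    also have "\<dots> = 0"
    proof (rule sum_antisymmetric)
      fix v w assume vw: "v \<in> U - \<tau>" "w \<in> U - \<tau>" "v \<noteq> w"
      have sw: "face_sign (insert w (insert v \<tau>)) v * face_sign (insert w \<tau>) w =
         - (face_sign (insert w (insert v \<tau>)) w * face_sign (insert v \<tau>) v :: 'r)"
        by (rule face_sign_swap) (use vw \<open>finite \<tau>\<close> in auto)
      have "g v w = (face_sign (insert w (insert v \<tau>)) w * face_sign (insert v \<tau>) v)
          * c (insert w (insert v \<tau>))"
        by (simp add: g_def mult_ac)
      moreover have "g w v = (face_sign (insert w (insert v \<tau>)) v * face_sign (insert w \<tau>) w)
          * c (insert w (insert v \<tau>))"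
        unfolding g_def insert_commute[of v w] by (simp add: mult_ac)
      ultimately show "g v w = - g w v" unfolding sw by simp
    qed (use assms in auto)
    finally show ?thesis .
  qed (simp add: boundary_def)
qed

text \<open>A simplex without \<open>a\<close> is reached only by deleting \<open>a\<close>, which
  gives \<open>c\<close>. For a simplex with \<open>a\<close>, the term of the boundary of
  \<open>c\<close> that inserts \<open>a\<close> is the coefficient of \<open>c\<close> itself, and
  the other terms change sign when the two insertions are exchanged.\<close>

lemma boundary_cone:
  fixes c :: "'b set \<Rightarrow> 'r::comm_ring_1"
  assumes "finite U" "a \<in> U" "supported_on (Pow U) c"
  shows "boundary U (cone a c) = (\<lambda>\<sigma>. c \<sigma> - cone a (boundary U c) \<sigma>)"
proof
  fix \<sigma>
  consider "\<not> \<sigma> \<subseteq> U" | "\<sigma> \<subseteq> U" "a \<notin> \<sigma>" | "\<sigma> \<subseteq> U" "a \<in> \<sigma>" by blast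
  then show "boundary U (cone a c) \<sigma> = c \<sigma> - cone a (boundary U c) \<sigma>"
  proof cases
    case 1
    then have "\<not> \<sigma> - {a} \<subseteq> U" using assms(2) by auto
    with 1 show ?thesis using assms(3) by (auto simp: boundary_def cone_def supported_on_def)
  next
    case 2
    have "boundary U (cone a c) \<sigma> =
        (\<Sum>v\<in>U-\<sigma>. if v = a then face_sign (insert v \<sigma>) v * (face_sign (insert v \<sigma>) v * c \<sigma>) else 0)"
      using 2 by (auto simp: boundary_def cone_def intro!: sum.cong)
    also have "\<dots> = c \<sigma>"
      using assms 2 by (simp add: face_sign_square flip: mult.assoc)
    finally show ?thesis using 2 by (simp add: cone_def)
  next
    case 3
    define \<tau> where "\<tau> = \<sigma> - {a}"
    have \<sigma>: "\<sigma> = insert a \<tau>" "a \<notin> \<tau>" "finite \<tau>" "\<tau> \<subseteq> U"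
      using 3 assms(1) finite_subset unfolding \<tau>_def by auto
    have U: "U - \<tau> = insert a (U - \<sigma>)" using 3 by (auto simp: \<tau>_def)
    have "boundary U (cone a c) \<sigma> =
        (\<Sum>v\<in>U-\<sigma>. face_sign (insert v \<sigma>) v * (face_sign (insert v \<sigma>) a * c (insert v \<tau>)))"
    proof -
      have "insert v \<sigma> - {a} = insert v \<tau>" if "v \<in> U - \<sigma>" for v
        using that 3 by (auto simp: \<tau>_def)
      then show ?thesis using 3 by (auto simp: boundary_def cone_def intro!: sum.cong)
    qed
    also have "\<dots> = (\<Sum>v\<in>U-\<sigma>. - (face_sign \<sigma> a * (face_sign (insert v \<tau>) v * c (insert v \<tau>))))"
    proof (rule sum.cong)
      fix v assume v: "v \<in> U - \<sigma>"
      have sw: "face_sign (insert a (insert v \<tau>)) v * face_sign (insert a \<tau>) a =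
         - (face_sign (insert a (insert v \<tau>)) a * face_sign (insert v \<tau>) v :: 'r)"
        using v \<sigma> by (intro face_sign_swap) auto
      \<comment> \<open>A factor 1, written as the square of a sign, creates the product to which
        \<open>sw\<close> applies.\<close>
      have "face_sign (insert a (insert v \<tau>)) v * face_sign (insert a (insert v \<tau>)) a
        = face_sign (insert a (insert v \<tau>)) v * face_sign (insert a (insert v \<tau>)) a
          * (face_sign (insert a \<tau>) a * face_sign (insert a \<tau>) a :: 'r)"
        by (simp add: face_sign_square)
      also have "\<dots> = (face_sign (insert a (insert v \<tau>)) v * face_sign (insert a \<tau>) a)
          * face_sign (insert a (insert v \<tau>)) a * face_sign (insert a \<tau>) a"
        by (simp only: mult_ac)
      also have "\<dots> = - (face_sign (insert a (insert v \<tau>)) a * face_sign (insert a (insert v \<tau>)) a)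
          * (face_sign (insert a \<tau>) a * face_sign (insert v \<tau>) v)"
        unfolding sw by (simp add: mult_ac)
      finally have "face_sign (insert v \<sigma>) v * face_sign (insert v \<sigma>) a =
          - (face_sign \<sigma> a * face_sign (insert v \<tau>) v :: 'r)"
        by (simp add: face_sign_square \<sigma>(1) insert_commute)
      then show "face_sign (insert v \<sigma>) v * (face_sign (insert v \<sigma>) a * c (insert v \<tau>)) =
          - (face_sign \<sigma> a * (face_sign (insert v \<tau>) v * c (insert v \<tau>)))"
        by (simp flip: mult.assoc)
    qed simp
    also have "\<dots> = c \<sigma> - cone a (boundary U c) \<sigma>"
    proof -
      have "cone a (boundary U c) \<sigma> = face_sign \<sigma> a * (\<Sum>v\<in>U - \<tau>. face_sign (insert v \<tau>) v * c (insert v \<tau>))"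
        using \<sigma> 3 by (simp add: cone_def boundary_def)
      also have "\<dots> = c \<sigma> + (\<Sum>v\<in>U-\<sigma>. face_sign \<sigma> a * (face_sign (insert v \<tau>) v * c (insert v \<tau>)))"
        unfolding U using 3 assms(1)
        by (simp add: distrib_left sum_distrib_left face_sign_square flip: mult.assoc \<sigma>(1))
      finally show ?thesis by (simp add: sum_negf)
    qed
    finally show ?thesis .
  qed
qed

lemma boundary_single_empty: "boundary U (single {}) = (\<lambda>_. 0)"
  by (auto simp: boundary_def single_def)

lemma boundary_single_vertex:
  assumes "finite U" "a \<in> U"
  shows "boundary U (single {a}) = (single {} :: 'b set \<Rightarrow> 'r::comm_ring_1)"
proof
  fix \<tau> :: "'b set"
  show "boundary U (single {a}) \<tau> = (single {} \<tau> :: 'r)"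
  proof (cases "\<tau> = {}")
    case True
    have "(\<Sum>v\<in>U. face_sign {v} v * single {a} {v}) = (\<Sum>v\<in>U. if v = a then 1 else 0 :: 'r)"
    proof (rule sum.cong)
      fix v :: 'b
      have "{u \<in> {v}. (u, v) \<in> vord \<and> u \<noteq> v} = {}" by auto
      then have "face_sign {v} v = (1 :: 'r)" unfolding face_sign_def by (metis card.empty power_0)
      then show "face_sign {v} v * single {a} {v} = (if v = a then 1 else 0 :: 'r)"
        by (auto simp: single_def)
    qed simp
    with True assms show ?thesis by (simp add: boundary_def single_def)
  next
    case False
    have "boundary U (single {a}) \<tau> = (0 :: 'r)"
    proof (rule ccontr)
      assume "boundary U (single {a}) \<tau> \<noteq> (0 :: 'r)"
      then obtain v where "v \<notin> \<tau>" "single {a} (insert v \<tau>) \<noteq> (0 :: 'r)"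
        by (rule boundary_nonzeroE)
      then show False using False by (auto simp: single_def split: if_splits)
    qed
    with False show ?thesis by (simp add: single_def)
  qed
qed

lemma boundary_single_nonzeroD:
  assumes "boundary U (single \<sigma>) \<tau> \<noteq> (0 :: 'r::comm_ring_1)" "finite \<sigma>"
  shows "\<tau> \<subseteq> \<sigma>" "card \<sigma> = Suc (card \<tau>)"
proof -
  obtain v where v: "v \<notin> \<tau>" "single \<sigma> (insert v \<tau>) \<noteq> (0 :: 'r)"
    using assms(1) by (rule boundary_nonzeroE)
  then have "\<sigma> = insert v \<tau>" by (auto simp: single_def split: if_splits)
  with v(1) assms(2) show "\<tau> \<subseteq> \<sigma>" "card \<sigma> = Suc (card \<tau>)" by auto
qed

lemma lin_ext_boundary:
  assumes "finite K" "supported_on K c"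
  shows "lin_ext A f (boundary U c) = lin_ext K (\<lambda>\<sigma>. lin_ext A f (boundary U (single \<sigma>))) c"
  using lin_ext_by_singles[OF assms] by (metis boundary_lin_ext lin_ext_lin_ext)

lemma exact_at_Pow:
  fixes R :: "'r::comm_ring_1 itself" and U :: "'b set"
  assumes "finite U" "Y \<subseteq> U" "Y \<noteq> {}" shows "exact_at R U (Pow Y) k"
  unfolding exact_at_def
proof (intro allI impI)
  fix c :: "'b set \<Rightarrow> 'r"
  assume c: "supported_on {\<sigma> \<in> Pow Y. card \<sigma> = k} c" "boundary U c = (\<lambda>_. 0)"
  obtain a where a: "a \<in> Y" using assms(3) by auto
  have "supported_on {\<sigma> \<in> Pow Y. card \<sigma> = Suc k} (cone a c)"
  proof (rule supported_onI)
    fix \<sigma> assume "cone a c \<sigma> \<noteq> 0"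
    then have "a \<in> \<sigma>" "c (\<sigma> - {a}) \<noteq> 0" by (auto simp: cone_def split: if_splits)
    then have *: "\<sigma> - {a} \<subseteq> Y" "card (\<sigma> - {a}) = k" "a \<in> \<sigma>" using supported_onD[OF c(1)] by auto
    then have "\<sigma> \<subseteq> Y" "finite \<sigma>" using a assms finite_subset[of \<sigma> U] by auto
    moreover have "card \<sigma> = Suc k"
      using card_Suc_Diff1[of \<sigma> a] \<open>finite \<sigma>\<close> * by metis
    ultimately show "\<sigma> \<in> {\<sigma> \<in> Pow Y. card \<sigma> = Suc k}" by blast
  qed
  moreover have "supported_on (Pow U) c" using c(1) assms(2) by (auto intro: supported_on_mono)
  then have "boundary U (cone a c) = (\<lambda>\<sigma>. c \<sigma> - cone a (boundary U c) \<sigma>)"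
    using a assms by (intro boundary_cone) auto
  then have "boundary U (cone a c) = c" by (auto simp: c(2) cone_def fun_eq_iff)
  ultimately show "\<exists>d. supported_on {\<sigma> \<in> Pow Y. card \<sigma> = Suc k} d \<and> boundary U d = c" by blast
qed

text \<open>\<open>bd\<close> tests membership in \<open>K\<close> at both ends,
  \<open>boundary\<close> only containment in \<open>U\<close>; closure under faces makes them agree
  on chains supported on \<open>K\<close>. The assumption \<open>{} \<in> K\<close> matches the
  empty simplex that \<open>simplices_of\<close> always adjoins.\<close>

lemma reduced_homology_vanishes_iff_exact_at:
  fixes R :: "'r::comm_ring_1 itself" and U :: "'b set"
  assumes U: "finite U" "K \<subseteq> Pow U" and K: "{} \<in> K" "\<And>\<sigma> v. \<sigma> \<in> K \<Longrightarrow> \<sigma> - {v} \<in> K"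
  shows "reduced_homology_vanishes R K (int k - 1) \<longleftrightarrow> exact_at R U K k"
proof -
  have fin: "finite \<sigma>" if "\<sigma> \<in> K" for \<sigma> using that U finite_subset by blast
  have simp: "simplices_of K (int j - 1) = {\<sigma>\<in>K. card \<sigma> = j}" for j
    using K(1) fin by (auto simp: simplices_of_def)
  have ch: "chains R K (int j - 1) = Collect (supported_on {\<sigma>\<in>K. card \<sigma> = j})" for j
    by (auto simp: chains_def supported_on_def simp)
  have bd: "bd K (int j - 1) c = boundary U c" if c: "supported_on {\<sigma>\<in>K. card \<sigma> = j} c"
    for j and c :: "'b set \<Rightarrow> 'r"
  proof
    fix \<tau>
    have face: "\<tau> \<in> simplices_of K (int j - 1 - 1)" if "v \<notin> \<tau>" "insert v \<tau> \<in> {\<sigma>\<in>K. card \<sigma> = j}" for v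
    proof -
      have "\<tau> \<in> K" using K(2)[of "insert v \<tau>" v] that by auto
      with that show ?thesis using fin by (auto simp: simplices_of_def)
    qed
    show "bd K (int j - 1) c \<tau> = boundary U c \<tau>"
    proof (cases "\<tau> \<in> simplices_of K (int j - 1 - 1)")
      case True
      then have "\<tau> \<subseteq> U" using U(2) by (auto simp: simplices_of_def)
      have "(\<Sum>v\<in>{v. v \<notin> \<tau> \<and> insert v \<tau> \<in> simplices_of K (int j - 1)}.
               face_sign (insert v \<tau>) v * c (insert v \<tau>)) =
            (\<Sum>v\<in>U - \<tau>. face_sign (insert v \<tau>) v * c (insert v \<tau>))"
        using U c by (intro sum.mono_neutral_left) (auto simp: simp supported_on_def)
      with True \<open>\<tau> \<subseteq> U\<close> show ?thesis by (simp add: bd_def boundary_def)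
    next
      case False
      then have "boundary U c \<tau> = 0"
        using face supported_onD[OF c] by (blast elim: boundary_nonzeroE)
      with False show ?thesis by (simp add: bd_def)
    qed
  qed
  have k: "int k - 1 + 1 = int (Suc k) - 1" by simp
  show ?thesis
    unfolding reduced_homology_vanishes_def exact_at_def k ch
    by (simp only: Ball_def Bex_def mem_Collect_eq bd cong: conj_cong imp_cong)
qed

section \<open>Homology relative to the non-colorful simplices\<close>

definition colorful :: "(nat \<Rightarrow> 'b set) \<Rightarrow> nat \<Rightarrow> 'b set \<Rightarrow> bool" where
  "colorful V k \<sigma> \<longleftrightarrow> (\<forall>i<k. \<sigma> \<inter> V i \<noteq> {})"

definition restrict_avoiding :: "'b set \<Rightarrow> ('b set \<Rightarrow> 'r::zero) \<Rightarrow> 'b set \<Rightarrow> 'r" where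
  "restrict_avoiding X c = (\<lambda>\<sigma>. if \<sigma> \<inter> X = {} then c \<sigma> else 0)"

text \<open>The augmentation for \<open>k\<close> colors, obtained by repeatedly taking the part of the boundary that
loses the last color.\<close>
primrec aug :: "'b set \<Rightarrow> (nat \<Rightarrow> 'b set) \<Rightarrow> nat \<Rightarrow> ('b set \<Rightarrow> 'r::comm_ring_1) \<Rightarrow> 'r" where
  "aug U V 0 c = c {}"
| "aug U V (Suc k) c = aug U V k (restrict_avoiding (V k) (boundary U c))"

lemma colorful_Suc: "colorful V (Suc k) \<sigma> \<longleftrightarrow> colorful V k \<sigma> \<and> \<sigma> \<inter> V k \<noteq> {}"
  by (auto simp: colorful_def less_Suc_eq)

lemma colorful_mono: "colorful V k \<sigma> \<Longrightarrow> \<sigma> \<subseteq> \<tau> \<Longrightarrow> colorful V k \<tau>"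
  unfolding colorful_def by blast

text \<open>Non-colorful simplices are closed under faces and span a subcomplex. Chains modulo it
  are handled throughout by comparing coefficients on colorful simplices only.\<close>

lemma boundary_not_colorful:
  assumes "\<And>\<sigma>. colorful V k \<sigma> \<Longrightarrow> c \<sigma> = 0" "colorful V k \<tau>"
  shows "boundary U c \<tau> = 0"
proof (rule ccontr)
  assume "boundary U c \<tau> \<noteq> 0"
  then obtain v where "c (insert v \<tau>) \<noteq> 0" by (rule boundary_nonzeroE)
  then show False using assms colorful_mono[of V k \<tau> "insert v \<tau>"] by blast
qed

lemma colorful_card:
  assumes "colorful V k \<sigma>" "finite \<sigma>" "disjoint_family_on V {..<k}"
  shows "k \<le> card \<sigma>"
proof -
  obtain f where f: "\<And>i. i < k \<Longrightarrow> f i \<in> \<sigma> \<inter> V i"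
  proof -
    have "\<forall>i. \<exists>x. i < k \<longrightarrow> x \<in> \<sigma> \<inter> V i" using assms(1) unfolding colorful_def by blast
    then show ?thesis using that by metis
  qed
  have "inj_on f {..<k}"
    using f assms(3) unfolding inj_on_def disjoint_family_on_def
    by (metis IntI Int_iff empty_iff lessThan_iff)
  then have "card {..<k} \<le> card \<sigma>"
    using f assms(2) by (intro card_inj_on_le[of f]) auto
  then show ?thesis by simp
qed

text \<open>The relative complex is zero below cardinality \<open>k\<close>, so chains of
  cardinality at most \<open>k\<close> are relative cycles.\<close>

lemma boundary_colorful_card:
  assumes "finite U" "disjoint_family_on V {..<k}" "colorful V k \<tau>"
    and "\<And>\<sigma>. c \<sigma> \<noteq> 0 \<Longrightarrow> card \<sigma> \<le> k"
  shows "boundary U c \<tau> = 0"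
proof (rule ccontr)
  assume "boundary U c \<tau> \<noteq> 0"
  then obtain v where v: "v \<notin> \<tau>" "c (insert v \<tau>) \<noteq> 0" "\<tau> \<subseteq> U" by (rule boundary_nonzeroE)
  then have fin: "finite \<tau>" using assms(1) finite_subset by blast
  then have "card \<tau> < k" using assms(4)[OF v(2)] v(1) by simp
  then show False using colorful_card[OF assms(3) fin assms(2)] by simp
qed

section \<open>Properties of the augmentation\<close>

lemma aug_diff: "aug U V k (\<lambda>x. c x - d x) = aug U V k c - aug U V k d"
proof (induction k arbitrary: c d)
  case (Suc k)
  have "restrict_avoiding (V k) (\<lambda>x. boundary U c x - boundary U d x) =
    (\<lambda>x. restrict_avoiding (V k) (boundary U c) x - restrict_avoiding (V k) (boundary U d) x)"
    by (auto simp: restrict_avoiding_def)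
  then show ?case by (simp add: boundary_diff Suc)
qed simp

lemma aug_zero: "aug U V k (\<lambda>_. 0) = 0"
  using aug_diff[of U V k "\<lambda>_. 0" "\<lambda>_. 0"] by simp

lemma aug_lin_ext: "aug U V k (lin_ext A f c) = (\<Sum>a\<in>A. c a * aug U V k (f a))"
proof (induction k arbitrary: f)
  case (Suc k)
  have "restrict_avoiding (V k) (lin_ext A (\<lambda>a. boundary U (f a)) c) =
      lin_ext A (\<lambda>a. restrict_avoiding (V k) (boundary U (f a))) c"
    by (auto simp: restrict_avoiding_def lin_ext_def)
  then show ?case by (simp add: boundary_lin_ext Suc)
qed (simp add: lin_ext_def)

lemma aug_boundary:
  assumes "finite U" "k > 0" shows "aug U V k (boundary U c) = 0"
  using assms
  by (cases k) (simp_all add: boundary_boundary restrict_avoiding_def aug_zero)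

text \<open>Each unfolding of \<open>aug\<close> takes one boundary, so the final coefficient at the
  empty set sees only simplices of cardinality \<open>k\<close>.\<close>

lemma aug_card:
  assumes "finite U" "\<And>\<sigma>. \<sigma> \<subseteq> U \<Longrightarrow> card \<sigma> = k \<Longrightarrow> c \<sigma> = 0"
  shows "aug U V k c = 0"
  using assms(2)
proof (induction k arbitrary: c)
  case (Suc k)
  have "boundary U c \<tau> = 0" if \<tau>: "\<tau> \<subseteq> U" "card \<tau> = k" for \<tau>
  proof (rule ccontr)
    assume "boundary U c \<tau> \<noteq> 0"
    then obtain v where v: "v \<in> U" "v \<notin> \<tau>" "c (insert v \<tau>) \<noteq> 0" by (rule boundary_nonzeroE)
    have "finite \<tau>" using \<tau>(1) assms(1) finite_subset by blast
    then show False using Suc.prems[of "insert v \<tau>"] v \<tau> by auto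
  qed
  then show ?case by (simp, intro Suc.IH) (simp add: restrict_avoiding_def)
qed simp

text \<open>This makes the augmentation well defined on relative chains. Simplices avoiding the last
  color contribute a boundary that the restriction leaves unchanged, and the augmentation kills
  boundaries. The others miss an earlier color, and so do their faces.\<close>

lemma aug_not_colorful:
  assumes "finite U"
    and "\<And>\<sigma>. c \<sigma> \<noteq> 0 \<Longrightarrow> \<sigma> \<subseteq> (\<Union>i<k. V i) \<and> \<not> colorful V k \<sigma>"
  shows "aug U V k c = 0"
  using assms(2)
proof (induction k arbitrary: c)
  case 0
  then show ?case by (auto simp: colorful_def)
next
  case (Suc k)
  define c1 where "c1 = restrict_avoiding (V k) c"
  have r: "restrict_avoiding (V k) (boundary U (\<lambda>x. c x - c1 x)) \<tau> \<noteq> 0 \<Longrightarrow>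
      \<tau> \<subseteq> (\<Union>i<k. V i) \<and> \<not> colorful V k \<tau>" for \<tau>
  proof -
    assume *: "restrict_avoiding (V k) (boundary U (\<lambda>x. c x - c1 x)) \<tau> \<noteq> 0"
    then have \<tau>: "\<tau> \<inter> V k = {}" "boundary U (\<lambda>x. c x - c1 x) \<tau> \<noteq> 0"
      by (auto simp: restrict_avoiding_def split: if_splits)
    from \<tau>(2) obtain v where v: "c (insert v \<tau>) - c1 (insert v \<tau>) \<noteq> 0" by (rule boundary_nonzeroE)
    then have "insert v \<tau> \<inter> V k \<noteq> {}" "c (insert v \<tau>) \<noteq> 0"
      by (auto simp: c1_def restrict_avoiding_def split: if_splits)
    with Suc.prems[of "insert v \<tau>"] have "insert v \<tau> \<subseteq> (\<Union>i<Suc k. V i)" "\<not> colorful V k (insert v \<tau>)"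
      by (auto simp: colorful_Suc)
    with \<tau>(1) show ?thesis using colorful_mono[of V k \<tau> "insert v \<tau>"] by (auto simp: lessThan_Suc)
  qed
  have c1: "aug U V (Suc k) c1 = 0"
  proof -
    have c1_avoid: "\<tau> \<inter> V k = {}" if "boundary U c1 \<tau> \<noteq> 0" for \<tau>
      using that by (rule boundary_nonzeroE) (auto simp: c1_def restrict_avoiding_def split: if_splits)
    then have "restrict_avoiding (V k) (boundary U c1) = boundary U c1"
      by (auto simp: restrict_avoiding_def fun_eq_iff)
    moreover have "aug U V k (boundary U c1) = 0"
    \<comment> \<open>\<open>aug_boundary\<close> needs at least one color. For
      \<open>k = 0\<close>, a simplex contained in \<open>V 0\<close> and avoiding
      \<open>V 0\<close> is empty, so no vertex contributes.\<close>
    proof (cases k)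
      case 0
      have "boundary U c1 {} = 0"
      proof (rule ccontr)
        assume "boundary U c1 {} \<noteq> 0"
        then obtain v where "c1 {v} \<noteq> 0" by (rule boundary_nonzeroE)
        then have "{v} \<inter> V 0 = {}" "c {v} \<noteq> 0"
          using 0 by (auto simp: c1_def restrict_avoiding_def split: if_splits)
        then show False using Suc.prems[of "{v}"] 0 by auto
      qed
      with 0 show ?thesis by simp
    qed (simp add: aug_boundary assms(1) del: aug.simps)
    ultimately show ?thesis by simp
  qed
  have "aug U V (Suc k) (\<lambda>x. c x - c1 x) = 0"
    by (simp, rule Suc.IH) (use r in blast)
  with c1 show ?case by (simp only: aug_diff diff_zero)
qed

text \<open>\<open>J\<close> lists the colors present, \<open>{..<k}\<close> those whose absence
  kills a simplex. In the induction the connecting map sends \<open>z\<close> to the part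
  \<open>y\<close> of its boundary that loses color \<open>k\<close>, a relative cycle for
  \<open>k\<close> colors on \<open>J - {k}\<close>. Once \<open>y\<close> is the relative boundary
  of some \<open>w\<close>, the chain \<open>z - w\<close> is a relative cycle for \<open>k\<close>
  colors on \<open>J\<close>. The condition on \<open>aug\<close> covers the case where
  \<open>J - S\<close> is empty, for which no exactness is assumed.\<close>

lemma relative_vanishing:
  fixes R :: "'r::comm_ring_1 itself" and K :: "'b set set" and z :: "'b set \<Rightarrow> 'r"
  assumes U: "finite U" "K \<subseteq> Pow U" and K: "\<And>\<sigma> v. \<sigma> \<in> K \<Longrightarrow> \<sigma> - {v} \<in> K"
    and "disjoint_family_on V J" "{..<k} \<subseteq> J"
    and "\<And>S. S \<subseteq> {..<k} \<Longrightarrow> J - S \<noteq> {} \<Longrightarrow> card S \<le> j \<Longrightarrow>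
           exact_at R U (induced K (\<Union>i\<in>J - S. V i)) (j - card S)"
    and "supported_on {\<sigma>\<in>induced K (\<Union>i\<in>J. V i). card \<sigma> = j} z"
    and "\<And>\<tau>. colorful V k \<tau> \<Longrightarrow> boundary U z \<tau> = 0"
    and "J = {..<k} \<Longrightarrow> aug U V k z = 0"
  shows "\<exists>w. supported_on {\<sigma>\<in>induced K (\<Union>i\<in>J. V i). card \<sigma> = Suc j} w \<and>
             (\<forall>\<tau>. colorful V k \<tau> \<longrightarrow> z \<tau> = boundary U w \<tau>)"
  using assms(4-)
proof (induction k arbitrary: J j z)
  case 0
  have cyc: "boundary U z = (\<lambda>_. 0)" using "0.prems"(5) by (auto simp: colorful_def)
  show ?case
  proof (cases "J = {}")
    case True
    \<comment> \<open>Only the empty simplex is left, and its coefficient is the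
      augmentation.\<close>
    have "z \<tau> = 0" for \<tau>
    proof (cases "\<tau> = {}")
      case False
      then show ?thesis using supported_onD[OF "0.prems"(4), of \<tau>] True by (auto simp: induced_def)
    qed (use "0.prems"(6) True in simp)
    then have "z = (\<lambda>_. 0)" by auto
    then show ?thesis by (intro exI[of _ "\<lambda>_. 0"]) (auto simp: supported_on_def boundary_zero)
  next
    case False
    then have "exact_at R U (induced K (\<Union>i\<in>J. V i)) j" using "0.prems"(3)[of "{}"] by auto
    then obtain w where "supported_on {\<sigma>\<in>induced K (\<Union>i\<in>J. V i). card \<sigma> = Suc j} w" "boundary U w = z"
      using "0.prems"(4) cyc unfolding exact_at_def by blast
    then show ?thesis by auto
  qed
next
  case (Suc k)
  note disj = Suc.prems(1) and sub = Suc.prems(2) and ex = Suc.prems(3) and supp = Suc.prems(4)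
    and bz = Suc.prems(5) and augz = Suc.prems(6)
  have kJ: "k \<in> J" "{..<k} \<subseteq> J - {k}" using sub by auto
  have ind: "\<sigma> - {v} \<in> induced K X" if "\<sigma> \<in> induced K X" for \<sigma> v X
    using that K by (auto simp: induced_def)
  show ?case
  proof (cases j)
    case 0
    \<comment> \<open>The empty simplex is not colorful once there is a color, so \<open>z\<close>
      is already zero as a relative chain.\<close>
    have "z \<tau> = 0" if "colorful V (Suc k) \<tau>" for \<tau>
    proof (rule ccontr)
      assume "z \<tau> \<noteq> 0"
      then have "\<tau> \<in> K" "card \<tau> = 0" using supported_onD[OF supp] 0 by (auto simp: induced_def)
      then have "\<tau> = {}" using U finite_subset[of \<tau> U] by auto
      with that show False by (auto simp: colorful_def)
    qed
    then show ?thesis by (intro exI[of _ "\<lambda>_. 0"]) (auto simp: supported_on_def boundary_zero)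
  next
    case (Suc j')
    define y where "y \<tau> = (if colorful V k \<tau> \<and> \<tau> \<inter> V k = {} then boundary U z \<tau> else 0)" for \<tau>
    define q where "q \<tau> = boundary U z \<tau> - y \<tau>" for \<tau>
    have suppd: "supported_on {\<sigma>\<in>induced K (\<Union>i\<in>J. V i). card \<sigma> = j'} (boundary U z)"
      by (rule supported_on_boundary[OF U(1) supp[unfolded Suc] ind])
    have q: "q \<tau> = 0" if "colorful V k \<tau>" for \<tau>
      using that bz[of \<tau>] by (auto simp: q_def y_def colorful_Suc)
    have "y = (\<lambda>\<tau>. boundary U z \<tau> - q \<tau>)" by (auto simp: q_def)
    \<comment> \<open>On simplices that meet the first \<open>k\<close> colors, \<open>y\<close>
      agrees with the boundary of \<open>z\<close>, whose boundary is zero.\<close>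
    then have by0: "boundary U y \<tau> = 0" if "colorful V k \<tau>" for \<tau>
      using boundary_not_colorful[OF q that] U(1) by (simp add: boundary_diff boundary_boundary)
    have suppy: "supported_on {\<sigma>\<in>induced K (\<Union>i\<in>J - {k}. V i). card \<sigma> = j'} y"
    proof (rule supported_onI)
      fix \<tau> assume "y \<tau> \<noteq> 0"
      then have "\<tau> \<inter> V k = {}" "boundary U z \<tau> \<noteq> 0" by (auto simp: y_def split: if_splits)
      moreover have "\<tau> \<in> K" "\<tau> \<subseteq> (\<Union>i\<in>J. V i)" "card \<tau> = j'"
        using supported_onD[OF suppd calculation(2)] by (auto simp: induced_def)
      moreover from calculation have "\<tau> \<subseteq> (\<Union>i\<in>J - {k}. V i)" by blast
      ultimately show "\<tau> \<in> {\<sigma>\<in>induced K (\<Union>i\<in>J - {k}. V i). card \<sigma> = j'}"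
        by (simp add: induced_def)
    qed
    have augy: "aug U V k y = 0" if J: "J - {k} = {..<k}"
    proof -
      have "J = {..<Suc k}" using J kJ(1) by (auto simp: lessThan_Suc)
      then have "aug U V k (restrict_avoiding (V k) (boundary U z)) = 0" using augz by simp
      \<comment> \<open>\<open>aug\<close> restricts the boundary of \<open>z\<close> to simplices
        avoiding \<open>V k\<close>, whereas \<open>y\<close> also drops the non-colorful ones; the
        augmentation does not see the difference.\<close>
      moreover have "aug U V k (\<lambda>\<tau>. restrict_avoiding (V k) (boundary U z) \<tau> - y \<tau>) = 0"
      proof (rule aug_not_colorful[OF U(1)])
        fix \<sigma> assume "restrict_avoiding (V k) (boundary U z) \<sigma> - y \<sigma> \<noteq> 0"
        then have *: "\<sigma> \<inter> V k = {}" "\<not> colorful V k \<sigma>" "boundary U z \<sigma> \<noteq> 0"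
          by (auto simp: restrict_avoiding_def y_def split: if_splits)
        then have "\<sigma> \<subseteq> (\<Union>i<Suc k. V i)"
          using supported_onD[OF suppd *(3)] \<open>J = {..<Suc k}\<close> by (auto simp: induced_def)
        with * show "\<sigma> \<subseteq> (\<Union>i<k. V i) \<and> \<not> colorful V k \<sigma>" by (auto simp: lessThan_Suc)
      qed
      ultimately show ?thesis by (simp add: aug_diff)
    qed
    have "\<exists>w. supported_on {\<sigma>\<in>induced K (\<Union>i\<in>J - {k}. V i). card \<sigma> = Suc j'} w \<and>
             (\<forall>\<tau>. colorful V k \<tau> \<longrightarrow> y \<tau> = boundary U w \<tau>)"
    proof (rule Suc.IH)
      show "disjoint_family_on V (J - {k})" using disj by (auto simp: disjoint_family_on_def)
    next
      fix S assume S: "S \<subseteq> {..<k}" "J - {k} - S \<noteq> {}" "card S \<le> j'"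
      have "finite S" "k \<notin> S" using S(1) finite_subset[OF S(1)] by auto
      \<comment> \<open>Removing \<open>S\<close> from \<open>J - {k}\<close> means removing
        \<open>insert k S\<close> from \<open>J\<close>: the extra color accounts for the drop from
        \<open>j\<close> to \<open>j'\<close>.\<close>
      then have "card (insert k S) = Suc (card S)" "J - {k} - S = J - insert k S" by auto
      then show "exact_at R U (induced K (\<Union>i\<in>J - {k} - S. V i)) (j' - card S)"
        using ex[of "insert k S"] S Suc by (simp add: lessThan_Suc insert_mono subset_insertI2)
    qed (fact kJ(2) suppy by0 augy)+
    then obtain w where w: "supported_on {\<sigma>\<in>induced K (\<Union>i\<in>J - {k}. V i). card \<sigma> = j} w"
      "\<And>\<tau>. colorful V k \<tau> \<Longrightarrow> y \<tau> = boundary U w \<tau>" using Suc by auto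
    have "\<exists>u. supported_on {\<sigma>\<in>induced K (\<Union>i\<in>J. V i). card \<sigma> = Suc j} u \<and>
             (\<forall>\<tau>. colorful V k \<tau> \<longrightarrow> z \<tau> - w \<tau> = boundary U u \<tau>)"
    proof (rule Suc.IH)
      show "supported_on {\<sigma>\<in>induced K (\<Union>i\<in>J. V i). card \<sigma> = j} (\<lambda>\<tau>. z \<tau> - w \<tau>)"
        by (rule supported_on_diff[OF supp supported_on_mono[OF w(1)]]) (auto simp: induced_def)
    next
      fix \<tau> assume "colorful V k \<tau>"
      then show "boundary U (\<lambda>\<tau>. z \<tau> - w \<tau>) \<tau> = 0"
        using q[of \<tau>] w(2)[of \<tau>] by (simp add: boundary_diff q_def)
    next
      fix S assume S: "S \<subseteq> {..<k}" "J - S \<noteq> {}" "card S \<le> j"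
      then show "exact_at R U (induced K (\<Union>i\<in>J - S. V i)) (j - card S)"
        by (intro ex) auto
    next
      show "{..<k} \<subseteq> J" using kJ(2) by blast
    next
      assume "J = {..<k}"
      then show "aug U V k (\<lambda>\<tau>. z \<tau> - w \<tau>) = 0" using kJ(1) by simp
    qed (fact disj)
    then obtain u where u: "supported_on {\<sigma>\<in>induced K (\<Union>i\<in>J. V i). card \<sigma> = Suc j} u"
      "\<And>\<tau>. colorful V k \<tau> \<Longrightarrow> z \<tau> - w \<tau> = boundary U u \<tau>" by blast
    have "z \<tau> = boundary U u \<tau>" if \<tau>: "colorful V (Suc k) \<tau>" for \<tau>
    proof -
      \<comment> \<open>\<open>w\<close> uses no vertex of color \<open>k\<close>, so correcting
        \<open>z\<close> by it changes nothing on simplices that meet all \<open>Suc k\<close>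
        colors.\<close>
      have "w \<tau> = 0"
      proof (rule ccontr)
        assume "w \<tau> \<noteq> 0"
        then have "\<tau> \<subseteq> (\<Union>i\<in>J - {k}. V i)" using supported_onD[OF w(1)] by (auto simp: induced_def)
        moreover have "V i \<inter> V k = {}" if "i \<in> J - {k}" for i
          using that disj kJ(1) by (auto simp: disjoint_family_on_def)
        ultimately have "\<tau> \<inter> V k = {}" by blast
        with \<tau> show False by (simp add: colorful_Suc)
      qed
      then show ?thesis using u(2)[of \<tau>] \<tau> by (simp add: colorful_Suc)
    qed
    with u(1) show ?thesis by blast
  qed
qed

text \<open>Exactness at the augmentation itself. The chain \<open>w\<close> obtained for
  \<open>k\<close> colors is a relative cycle by cardinality; with color \<open>k\<close> available
  it is filled by \<open>u\<close>. The part of the boundary of \<open>u\<close> that loses color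
  \<open>k\<close> is \<open>w\<close> up to non-colorful simplices, so the augmentations
  agree.\<close>

lemma aug_onto:
  fixes R :: "'r::comm_ring_1 itself" and K :: "'b set set"
  assumes U: "finite U" "K \<subseteq> Pow U" and K: "{} \<in> K" "\<And>\<sigma> v. \<sigma> \<in> K \<Longrightarrow> \<sigma> - {v} \<in> K"
    and "disjoint_family_on V {..<k}"
    and "\<And>I. I \<noteq> {} \<Longrightarrow> I \<subseteq> {..<k} \<Longrightarrow> exact_at R U (induced K (\<Union>i\<in>I. V i)) (card I - 1)"
  shows "\<exists>w :: 'b set \<Rightarrow> 'r. supported_on {\<sigma>\<in>induced K (\<Union>i<k. V i). card \<sigma> = k} w \<and> aug U V k w = 1"
  using assms(5-)
proof (induction k)
  case 0
  have "supported_on {\<sigma>\<in>induced K (\<Union>i<0. V i). card \<sigma> = 0} (single {} :: 'b set \<Rightarrow> 'r)"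
    using K(1) by (intro supported_on_mono[OF supported_on_single]) (auto simp: induced_def)
  then show ?case by (intro exI[of _ "single {}"]) (simp add: single_def)
next
  case (Suc k)
  have "disjoint_family_on V {..<k}" using Suc.prems(1) by (auto simp: disjoint_family_on_def)
  then obtain w :: "'b set \<Rightarrow> 'r" where
    w: "supported_on {\<sigma>\<in>induced K (\<Union>i<k. V i). card \<sigma> = k} w" "aug U V k w = 1"
    using Suc.IH Suc.prems(2) by (metis lessThan_Suc subset_insertI2)
  have disj: "V i \<inter> V k = {}" if "i < k" for i
    using that Suc.prems(1) by (auto simp: disjoint_family_on_def)
  have "\<exists>u. supported_on {\<sigma>\<in>induced K (\<Union>i<Suc k. V i). card \<sigma> = Suc k} u \<and>
             (\<forall>\<tau>. colorful V k \<tau> \<longrightarrow> w \<tau> = boundary U u \<tau>)"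
  \<comment> \<open>There are \<open>Suc k\<close> colors present, but the chains are relative to
    only \<open>k\<close> of them, so no augmentation condition arises.\<close>
  proof (rule relative_vanishing[OF U K(2)])
    show "supported_on {\<sigma>\<in>induced K (\<Union>i<Suc k. V i). card \<sigma> = k} w"
      using w(1) by (rule supported_on_mono) (auto simp: induced_def lessThan_Suc)
  next
    fix \<tau> assume \<tau>: "colorful V k \<tau>"
    show "boundary U w \<tau> = 0"
      by (rule boundary_colorful_card[OF U(1) \<open>disjoint_family_on V {..<k}\<close> \<tau>])
        (use supported_onD[OF w(1)] in auto)
  next
    fix S assume S: "S \<subseteq> {..<k}" "{..<Suc k} - S \<noteq> {}" "card S \<le> k"
    have "card ({..<Suc k} - S) = Suc k - card S"
      using S(1) by (subst card_Diff_subset) (auto intro: finite_subset)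
    then show "exact_at R U (induced K (\<Union>i\<in>{..<Suc k} - S. V i)) (k - card S)"
      using Suc.prems(2)[of "{..<Suc k} - S"] S by auto
  qed (use Suc.prems in auto)
  then obtain u where u: "supported_on {\<sigma>\<in>induced K (\<Union>i<Suc k. V i). card \<sigma> = Suc k} u"
    "\<And>\<tau>. colorful V k \<tau> \<Longrightarrow> w \<tau> = boundary U u \<tau>" by blast
  have suppd: "supported_on {\<sigma>\<in>induced K (\<Union>i<Suc k. V i). card \<sigma> = k} (boundary U u)"
    using U(1) u(1) K(2) by (intro supported_on_boundary) (auto simp: induced_def)
  have "aug U V k (\<lambda>\<tau>. restrict_avoiding (V k) (boundary U u) \<tau> - w \<tau>) = 0"
  proof (rule aug_not_colorful[OF U(1)])
    fix \<sigma> assume *: "restrict_avoiding (V k) (boundary U u) \<sigma> - w \<sigma> \<noteq> 0"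
    show "\<sigma> \<subseteq> (\<Union>i<k. V i) \<and> \<not> colorful V k \<sigma>"
    proof (cases "w \<sigma> = 0")
      case True
      with * have "\<sigma> \<inter> V k = {}" "boundary U u \<sigma> \<noteq> 0"
        by (auto simp: restrict_avoiding_def split: if_splits)
      with supported_onD[OF suppd this(2)] u(2)[of \<sigma>] True show ?thesis
        by (auto simp: induced_def lessThan_Suc)
    next
      case False
      then have "\<sigma> \<subseteq> (\<Union>i<k. V i)" using supported_onD[OF w(1)] by (auto simp: induced_def)
      moreover from this have "\<sigma> \<inter> V k = {}" using disj by fastforce
      ultimately show ?thesis using * u(2)[of \<sigma>] by (auto simp: restrict_avoiding_def)
    qed
  qed
  then have "aug U V (Suc k) u = 1" using w(2) by (simp add: aug_diff)
  with u(1) show ?case by blast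
qed

section \<open>Comparison with the colorful complex\<close>

locale colored_complex =
  fixes R :: "'r::comm_ring_1 itself" and C :: "'a set set" and V :: "nat \<Rightarrow> 'a set" and n :: nat
  assumes finite_C: "finite C" and complex: "simplicial_complex C" and empty_in: "{} \<in> C"
    and disj: "disjoint_family_on V {..<Suc n}" and cover: "\<Union>C = (\<Union>i<Suc n. V i)"
begin

abbreviation U where "U \<equiv> \<Union>C"
abbreviation P where "P \<equiv> colorful_simplices C V n"
abbreviation \<Delta> where "\<Delta> \<equiv> Col C V n"
abbreviation \<epsilon> :: "('a set \<Rightarrow> 'r) \<Rightarrow> 'r" where "\<epsilon> \<equiv> aug U V (Suc n)"

lemma face_in: "\<sigma> \<in> C \<Longrightarrow> \<tau> \<subseteq> \<sigma> \<Longrightarrow> \<tau> \<in> C"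
  using complex by (auto simp: simplicial_complex_def)

lemma finite_simplex: "\<sigma> \<in> C \<Longrightarrow> finite \<sigma>"
  using complex by (auto simp: simplicial_complex_def)

lemma finite_U: "finite U"
  using finite_C finite_simplex by auto

lemma C_sub: "C \<subseteq> Pow U" by auto

lemma P_iff: "\<sigma> \<in> P \<longleftrightarrow> \<sigma> \<in> C \<and> colorful V (Suc n) \<sigma>"
  by (auto simp: colorful_simplices_def colorful_def less_Suc_eq_le)

lemma finite_P: "finite P"
  by (rule finite_subset[OF _ finite_C]) (auto simp: P_iff)

lemma \<Delta>_sub: "\<Delta> \<subseteq> Pow P" by (auto simp: Col_def)

lemma finite_\<Delta>: "finite \<Delta>"
  using finite_subset[OF \<Delta>_sub] finite_P by auto

lemma \<Delta>_face: "s \<in> \<Delta> \<Longrightarrow> t \<subseteq> s \<Longrightarrow> t \<in> \<Delta>"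
  unfolding Col_def by (simp, meson finite_subset subset_trans subsetD)

lemma finite_\<Delta>_simplex: "s \<in> \<Delta> \<Longrightarrow> finite s"
  by (simp add: Col_def)

lemma empty_\<Delta>: "{} \<in> \<Delta>" by (simp add: Col_def)

lemma \<Delta>_insert:
  assumes "s \<in> \<Delta>" "\<sigma> \<in> P" "\<And>\<tau>. \<tau> \<in> s \<Longrightarrow> \<tau> \<subseteq> \<sigma>" shows "insert \<sigma> s \<in> \<Delta>"
  using assms unfolding Col_def by auto

text \<open>A maximal member of a finite nonempty chain contains all others, so the union is itself
  a member.\<close>

lemma Union_\<Delta>:
  assumes "s \<in> \<Delta>" "s \<noteq> {}" shows "\<Union>s \<in> P"
proof -
  obtain M where M: "M \<in> s" "\<And>\<tau>. \<tau> \<in> s \<Longrightarrow> M \<subseteq> \<tau> \<Longrightarrow> M = \<tau>"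
    using finite_has_maximal[OF finite_\<Delta>_simplex[OF assms(1)] assms(2)] by blast
  have "\<tau> \<subseteq> M" if "\<tau> \<in> s" for \<tau>
  proof -
    have "\<tau> \<subseteq> M \<or> M \<subseteq> \<tau>" using assms(1) that M(1) by (simp add: Col_def)
    then show ?thesis using M(2)[OF that] by auto
  qed
  then have "\<Union>s = M" using M(1) by (intro equalityI Union_least Union_upper)
  moreover have "M \<in> P" using assms(1) M(1) by (auto simp: Col_def)
  ultimately show ?thesis by simp
qed

text \<open>All members of the chains lie below \<open>\<sigma>\<close>, so adjoining
  \<open>\<sigma>\<close> gives a chain again. The offset \<open>p\<close> serves both uses:
  \<open>n\<close> for the subdivision, 0 for the homotopy.\<close>

lemma cone_support:
  assumes "supported_on {t\<in>\<Delta>. (\<forall>\<tau>\<in>t. \<tau> \<subseteq> \<sigma>) \<and> card t + p = q} x" "\<sigma> \<in> P"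
  shows "supported_on {t\<in>\<Delta>. (\<forall>\<tau>\<in>t. \<tau> \<subseteq> \<sigma>) \<and> card t + p = Suc q} (cone \<sigma> x)"
proof (rule supported_onI)
  fix t assume "cone \<sigma> x t \<noteq> 0"
  then have t: "\<sigma> \<in> t" "x (t - {\<sigma>}) \<noteq> 0" by (auto simp: cone_def split: if_splits)
  have t': "t - {\<sigma>} \<in> \<Delta>" "\<And>\<tau>. \<tau> \<in> t - {\<sigma>} \<Longrightarrow> \<tau> \<subseteq> \<sigma>" "card (t - {\<sigma>}) + p = q"
    using supported_onD[OF assms(1) t(2)] by blast+
  have "insert \<sigma> (t - {\<sigma>}) = t" using t(1) by auto
  then have "t \<in> \<Delta>" using \<Delta>_insert[OF t'(1) assms(2) t'(2)] by simp
  moreover have "card t = Suc (card (t - {\<sigma>}))"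
    using card_Suc_Diff1[OF finite_\<Delta>_simplex[OF \<open>t \<in> \<Delta>\<close>] t(1)] by simp
  ultimately show "t \<in> {t\<in>\<Delta>. (\<forall>\<tau>\<in>t. \<tau> \<subseteq> \<sigma>) \<and> card t + p = Suc q}"
    using t' by auto
qed

lemma boundary_cone_cycle:
  fixes x :: "'a set set \<Rightarrow> 'r"
  assumes "supported_on {t\<in>\<Delta>. (\<forall>\<tau>\<in>t. \<tau> \<subseteq> \<sigma>) \<and> card t + p = q} x" "\<sigma> \<in> P"
    and "boundary P x = (\<lambda>_. 0)"
  shows "boundary P (cone \<sigma> x) = x"
proof -
  have "boundary P (cone \<sigma> x) = (\<lambda>s. x s - cone \<sigma> (boundary P x) s)"
    using assms(2) finite_P \<Delta>_sub
    by (intro boundary_cone) (auto intro!: supported_on_mono[OF assms(1)])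
  then show ?thesis by (simp add: assms(3) cone_def cong: if_cong)
qed

lemma boundary_support:
  "supported_on {\<sigma>\<in>C. card \<sigma> = Suc j} c \<Longrightarrow> supported_on {\<sigma>\<in>C. card \<sigma> = j} (boundary U c)"
  by (rule supported_on_boundary[OF finite_U]) (auto intro: face_in)

lemma boundary_support_\<Delta>:
  "supported_on {s\<in>\<Delta>. card s = Suc j} c \<Longrightarrow> supported_on {s\<in>\<Delta>. card s = j} (boundary P c)"
  by (rule supported_on_boundary[OF finite_P]) (auto intro: \<Delta>_face)

lemma single_support: "a \<in> S \<Longrightarrow> supported_on S (single a)"
  by (rule supported_on_mono[OF supported_on_single]) auto

section \<open>The subdivision chain map\<close>

lemma \<epsilon>_boundary: "\<epsilon> (boundary U c) = 0"
  by (rule aug_boundary[OF finite_U]) simp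

text \<open>A non-colorful simplex has no colorful face, so the outer sum may run over
  \<open>P\<close> instead of \<open>C\<close>.\<close>

lemma lin_ext_boundary_colorful:
  fixes c :: "'a set \<Rightarrow> 'r"
  assumes "supported_on C c"
  shows "lin_ext P f (boundary U c) = lin_ext P (\<lambda>\<sigma>. lin_ext P f (boundary U (single \<sigma>))) c"
proof
  fix s
  have "(\<Sum>\<sigma>\<in>C. c \<sigma> * lin_ext P f (boundary U (single \<sigma>)) s) =
      (\<Sum>\<sigma>\<in>P. c \<sigma> * lin_ext P f (boundary U (single \<sigma>)) s)"
  proof (rule sum.mono_neutral_right[OF finite_C])
    show "\<forall>\<sigma>\<in>C - P. c \<sigma> * lin_ext P f (boundary U (single \<sigma>)) s = 0"
    proof
      fix \<sigma> assume \<sigma>: "\<sigma> \<in> C - P"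
      have "boundary U (single \<sigma>) \<tau> = (0 :: 'r)" if "\<tau> \<in> P" for \<tau>
        by (rule boundary_not_colorful[of V "Suc n"]) (use \<sigma> that in \<open>auto simp: P_iff single_def\<close>)
      then show "c \<sigma> * lin_ext P f (boundary U (single \<sigma>)) s = 0" by (simp add: lin_ext_def)
    qed
  qed (auto simp: P_iff)
  then show "lin_ext P f (boundary U c) s =
      lin_ext P (\<lambda>\<sigma>. lin_ext P f (boundary U (single \<sigma>))) c s"
    using fun_cong[OF lin_ext_boundary[OF finite_C assms, of P f U], of s]
    by (simp add: lin_ext_def)
qed

lemma \<epsilon>_colorful:
  assumes "supported_on C c" shows "\<epsilon> c = (\<Sum>\<sigma>\<in>P. c \<sigma> * \<epsilon> (single \<sigma>))"
proof -
  have "\<epsilon> c = \<epsilon> (lin_ext C single c)" using lin_ext_by_singles[OF finite_C assms] by simp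
  also have "\<dots> = (\<Sum>\<sigma>\<in>C. c \<sigma> * \<epsilon> (single \<sigma>))" by (rule aug_lin_ext)
  also have "\<dots> = (\<Sum>\<sigma>\<in>P. c \<sigma> * \<epsilon> (single \<sigma>))"
  proof (rule sum.mono_neutral_right[OF finite_C])
    show "\<forall>\<sigma>\<in>C - P. c \<sigma> * \<epsilon> (single \<sigma>) = 0"
    proof
      fix \<sigma> assume \<sigma>: "\<sigma> \<in> C - P"
      have "\<epsilon> (single \<sigma>) = 0"
      proof (rule aug_not_colorful[OF finite_U])
        fix \<tau> assume "single \<sigma> \<tau> \<noteq> (0 :: 'r)"
        then have "\<tau> = \<sigma>" by (auto simp: single_def split: if_splits)
        then show "\<tau> \<subseteq> (\<Union>i<Suc n. V i) \<and> \<not> colorful V (Suc n) \<tau>"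
          using \<sigma> by (auto simp: P_iff simp flip: cover)
      qed
      then show "c \<sigma> * \<epsilon> (single \<sigma>) = 0" by simp
    qed
  qed (auto simp: P_iff)
  finally show ?thesis .
qed

text \<open>The augmentation term starts the recursion: a simplex of cardinality
  \<open>Suc n\<close> has no colorful facet, so the base of its cone is a multiple of the empty
  chain. In other cardinalities the term is zero. \<open>sd 0\<close> is a dummy value, as the empty
  set is not colorful.\<close>

primrec sd :: "nat \<Rightarrow> 'a set \<Rightarrow> 'a set set \<Rightarrow> 'r" where
  "sd 0 \<sigma> = (\<lambda>_. 0)"
| "sd (Suc j) \<sigma> =
     cone \<sigma> (\<lambda>s. lin_ext P (sd j) (boundary U (single \<sigma>)) s + \<epsilon> (single \<sigma>) * single {} s)"

lemma sd_support_aux: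
  assumes IH: "\<And>\<tau>. \<tau> \<in> P \<Longrightarrow> card \<tau> = j \<Longrightarrow>
      supported_on {s\<in>\<Delta>. (\<forall>\<rho>\<in>s. \<rho> \<subseteq> \<tau>) \<and> card s + n = j} (sd j \<tau>)"
    and \<sigma>: "\<sigma> \<in> P" "card \<sigma> = Suc j"
  shows "supported_on {s\<in>\<Delta>. (\<forall>\<rho>\<in>s. \<rho> \<subseteq> \<sigma>) \<and> card s + n = j}
    (\<lambda>s. lin_ext P (sd j) (boundary U (single \<sigma>)) s + \<epsilon> (single \<sigma>) * single {} s)"
proof (rule supported_on_add)
  show "supported_on {s\<in>\<Delta>. (\<forall>\<rho>\<in>s. \<rho> \<subseteq> \<sigma>) \<and> card s + n = j}
      (lin_ext P (sd j) (boundary U (single \<sigma>)))"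
  proof (rule supported_on_lin_ext)
    fix \<tau> assume \<tau>: "\<tau> \<in> P" "boundary U (single \<sigma>) \<tau> \<noteq> (0 :: 'r)"
    have "finite \<sigma>" using \<sigma>(1) finite_simplex by (auto simp: P_iff)
    then have "\<tau> \<subseteq> \<sigma>" "card \<tau> = j" using boundary_single_nonzeroD[OF \<tau>(2)] \<sigma>(2) by auto
    then show "supported_on {s\<in>\<Delta>. (\<forall>\<rho>\<in>s. \<rho> \<subseteq> \<sigma>) \<and> card s + n = j} (sd j \<tau>)"
      by (intro supported_on_mono[OF IH[OF \<tau>(1)]]) auto
  qed
  show "supported_on {s\<in>\<Delta>. (\<forall>\<rho>\<in>s. \<rho> \<subseteq> \<sigma>) \<and> card s + n = j}
      (\<lambda>s. \<epsilon> (single \<sigma>) * single {} s)"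
  proof (cases "j = n")
    case True
    then show ?thesis using empty_\<Delta> by (auto simp: supported_on_def single_def)
  next
    case False
    then have "\<epsilon> (single \<sigma>) = 0"
      using \<sigma>(2) by (intro aug_card[OF finite_U]) (auto simp: single_def)
    then show ?thesis by (simp add: supported_on_def)
  qed
qed

lemma sd_support:
  assumes "\<sigma> \<in> P" "card \<sigma> = j"
  shows "supported_on {s\<in>\<Delta>. (\<forall>\<tau>\<in>s. \<tau> \<subseteq> \<sigma>) \<and> card s + n = j} (sd j \<sigma>)"
  using assms
proof (induction j arbitrary: \<sigma>)
  case 0
  then show ?case by (simp add: supported_on_def)
next
  case (Suc j)
  show ?case unfolding sd.simps
    by (rule cone_support[OF sd_support_aux[OF Suc.IH Suc.prems] Suc.prems(1)])
qed

text \<open>The formula for single simplices is an assumption so that the induction in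
  \<open>boundary_sd\<close> can use this lemma one cardinality lower.\<close>

lemma boundary_sd_lin_ext:
  assumes bd: "\<And>\<sigma>. \<sigma> \<in> P \<Longrightarrow> card \<sigma> = Suc j \<Longrightarrow> boundary P (sd (Suc j) \<sigma>) =
      (\<lambda>s. lin_ext P (sd j) (boundary U (single \<sigma>)) s + \<epsilon> (single \<sigma>) * single {} s)"
    and c: "supported_on {\<sigma>\<in>C. card \<sigma> = Suc j} c"
  shows "boundary P (lin_ext P (sd (Suc j)) c) =
      (\<lambda>s. lin_ext P (sd j) (boundary U c) s + \<epsilon> c * single {} s)"
proof
  fix s
  have c': "supported_on C c" by (rule supported_on_mono[OF c]) auto
  have "boundary P (lin_ext P (sd (Suc j)) c) s =
      lin_ext P (\<lambda>\<sigma> s. lin_ext P (sd j) (boundary U (single \<sigma>)) s + \<epsilon> (single \<sigma>) * single {} s) c s"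
    unfolding boundary_lin_ext
    by (rule lin_ext_cong) (use bd supported_onD[OF c] in auto)
  also have "\<dots> = lin_ext P (\<lambda>\<sigma>. lin_ext P (sd j) (boundary U (single \<sigma>))) c s
      + (\<Sum>\<sigma>\<in>P. c \<sigma> * \<epsilon> (single \<sigma>)) * single {} s"
    unfolding lin_ext_def[of P _ c] by (simp only: distrib_left sum.distrib sum_distrib_right mult.assoc)
  finally show "boundary P (lin_ext P (sd (Suc j)) c) s =
      lin_ext P (sd j) (boundary U c) s + \<epsilon> c * single {} s"
    by (simp only: lin_ext_boundary_colorful[OF c'] \<epsilon>_colorful[OF c'])
qed

text \<open>It suffices that the base of the cone is a cycle. By the formula one cardinality lower,
  its boundary consists of the image of a double boundary and the augmentation of a boundary, and
  both vanish.\<close>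

lemma boundary_sd:
  assumes "\<sigma> \<in> P" "card \<sigma> = Suc j"
  shows "boundary P (sd (Suc j) \<sigma>) =
    (\<lambda>s. lin_ext P (sd j) (boundary U (single \<sigma>)) s + \<epsilon> (single \<sigma>) * single {} s)"
  using assms
proof (induction j arbitrary: \<sigma>)
  case 0
  let ?x = "\<lambda>s. lin_ext P (sd 0) (boundary U (single \<sigma>)) s + \<epsilon> (single \<sigma>) * single {} s"
  have "boundary P ?x = (\<lambda>_. 0)"
    by (simp add: lin_ext_def boundary_scale boundary_single_empty)
  moreover have "supported_on {s\<in>\<Delta>. (\<forall>\<rho>\<in>s. \<rho> \<subseteq> \<sigma>) \<and> card s + n = 0} ?x"
    by (rule sd_support_aux[OF _ 0]) (rule sd_support)
  ultimately show ?case unfolding sd.simps(2) using 0(1) by (intro boundary_cone_cycle)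
next
  case (Suc j)
  have s: "supported_on {\<sigma>\<in>C. card \<sigma> = Suc j} (boundary U (single \<sigma>) :: _ \<Rightarrow> 'r)"
    using Suc.prems by (intro boundary_support single_support) (auto simp: P_iff)
  let ?x = "\<lambda>s. lin_ext P (sd (Suc j)) (boundary U (single \<sigma>)) s + \<epsilon> (single \<sigma>) * single {} s"
  have chain: "boundary P (lin_ext P (sd (Suc j)) (boundary U (single \<sigma>))) =
      (\<lambda>s. lin_ext P (sd j) (boundary U (boundary U (single \<sigma>))) s
        + \<epsilon> (boundary U (single \<sigma>)) * single {} s)"
    by (rule boundary_sd_lin_ext[OF _ s]) (rule Suc.IH)
  have "boundary P ?x = (\<lambda>_. 0)"
    unfolding boundary_add boundary_scale boundary_single_empty chain
      boundary_boundary[OF finite_U] lin_ext_zero \<epsilon>_boundary by simp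
  moreover have "supported_on {s\<in>\<Delta>. (\<forall>\<rho>\<in>s. \<rho> \<subseteq> \<sigma>) \<and> card s + n = Suc j} ?x"
    by (rule sd_support_aux[OF _ Suc.prems]) (rule sd_support)
  ultimately show ?case unfolding sd.simps(2)[of "Suc j"]
    using Suc.prems(1) by (intro boundary_cone_cycle)
qed

lemma boundary_sd_chain:
  assumes "supported_on {\<sigma>\<in>C. card \<sigma> = Suc j} c"
  shows "boundary P (lin_ext P (sd (Suc j)) c) =
      (\<lambda>s. lin_ext P (sd j) (boundary U c) s + \<epsilon> c * single {} s)"
  by (rule boundary_sd_lin_ext[OF _ assms]) (rule boundary_sd)

section \<open>The chain map from the colorful complex to relative chains\<close>

text \<open>The conditions on \<open>w\<close> to be an admissible image of \<open>s\<close>, where \<open>f\<close> is the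
already chosen image of the boundary of \<open>s\<close>.\<close>
definition fills :: "nat \<Rightarrow> 'a set set \<Rightarrow> ('a set \<Rightarrow> 'r) \<Rightarrow> ('a set \<Rightarrow> 'r) \<Rightarrow> bool" where
  "fills k s f w \<longleftrightarrow> supported_on {\<tau>. \<tau> \<subseteq> \<Union>s \<and> card \<tau> = Suc (k + n)} w \<and>
     (\<forall>\<tau>. colorful V (Suc n) \<tau> \<longrightarrow> boundary U w \<tau> = f \<tau>) \<and> \<epsilon> w = boundary P (single s) {}"

text \<open>Fillings are not canonical, hence the choice; \<open>\<phi>_fills\<close> shows that one
  exists. The empty chain is sent to 0, and the condition on \<open>\<epsilon>\<close> in
  \<open>fills\<close> takes over its role.\<close>

primrec \<phi> :: "nat \<Rightarrow> 'a set set \<Rightarrow> 'a set \<Rightarrow> 'r" where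
  "\<phi> 0 s = (\<lambda>_. 0)"
| "\<phi> (Suc k) s = (SOME w. fills k s (lin_ext \<Delta> (\<phi> k) (boundary P (single s))) w)"

lemma fills_support:
  assumes "fills k s f w" "s \<in> \<Delta>" "s \<noteq> {}"
  shows "supported_on {\<sigma>\<in>C. card \<sigma> = Suc (k + n)} w"
  using assms Union_\<Delta>[OF assms(2,3)] face_in unfolding fills_def
  by (auto elim!: supported_on_mono simp: P_iff)

lemma \<phi>_chain:
  assumes fills: "\<forall>s\<in>\<Delta>. card s = Suc k \<longrightarrow>
      fills k s (lin_ext \<Delta> (\<phi> k) (boundary P (single s))) (\<phi> (Suc k) s)"
    and c: "supported_on {s\<in>\<Delta>. card s = Suc k} c"
  shows "supported_on {\<sigma>\<in>C. card \<sigma> = Suc (k + n)} (lin_ext \<Delta> (\<phi> (Suc k)) c)"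
    and "colorful V (Suc n) \<tau> \<Longrightarrow>
      boundary U (lin_ext \<Delta> (\<phi> (Suc k)) c) \<tau> = lin_ext \<Delta> (\<phi> k) (boundary P c) \<tau>"
    and "\<epsilon> (lin_ext \<Delta> (\<phi> (Suc k)) c) = boundary P c {}"
proof -
  have c': "supported_on \<Delta> c" by (rule supported_on_mono[OF c]) auto
  have f: "fills k s (lin_ext \<Delta> (\<phi> k) (boundary P (single s))) (\<phi> (Suc k) s)"
    "s \<in> \<Delta>" "s \<noteq> {}" if "c s \<noteq> 0" for s
    using supported_onD[OF c that] fills by auto
  show "supported_on {\<sigma>\<in>C. card \<sigma> = Suc (k + n)} (lin_ext \<Delta> (\<phi> (Suc k)) c)"
    by (rule supported_on_lin_ext) (rule fills_support[OF f])
  show "boundary U (lin_ext \<Delta> (\<phi> (Suc k)) c) \<tau> = lin_ext \<Delta> (\<phi> k) (boundary P c) \<tau>"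
    if "colorful V (Suc n) \<tau>"
    unfolding boundary_lin_ext lin_ext_boundary[OF finite_\<Delta> c']
    by (rule lin_ext_cong) (use f(1) that in \<open>auto simp: fills_def\<close>)
  have "\<epsilon> (lin_ext \<Delta> (\<phi> (Suc k)) c) = (\<Sum>s\<in>\<Delta>. c s * \<epsilon> (\<phi> (Suc k) s))" by (rule aug_lin_ext)
  also have "\<dots> = lin_ext \<Delta> (\<lambda>s. boundary P (single s)) c {}"
    unfolding lin_ext_def
  proof (rule sum.cong)
    fix s
    show "c s * \<epsilon> (\<phi> (Suc k) s) = c s * boundary P (single s) {}"
    proof (cases "c s = 0")
      case False
      then have "\<epsilon> (\<phi> (Suc k) s) = boundary P (single s) {}" using f(1) unfolding fills_def by blast
      then show ?thesis by (simp only:)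
    qed simp
  qed simp
  also have "\<dots> = boundary P c {}"
    by (simp only: lin_ext_by_singles[OF finite_\<Delta> c'] flip: boundary_lin_ext)
  finally show "\<epsilon> (lin_ext \<Delta> (\<phi> (Suc k)) c) = boundary P c {}" .
qed

lemma induced_Pow_cover: "Y \<in> C \<Longrightarrow> induced (Pow Y) (\<Union>i<Suc n. V i) = Pow Y"
  unfolding induced_def cover[symmetric] by auto

text \<open>A colorful simplex meets every class, so these induced complexes are full simplices on
  nonempty sets and can be coned off.\<close>

lemma exact_at_colorful_simplex:
  assumes "Y \<in> P" "I \<noteq> {}" "I \<subseteq> {..<Suc n}"
  shows "exact_at R U (induced (Pow Y) (\<Union>i\<in>I. V i)) k"
proof -
  have "induced (Pow Y) (\<Union>i\<in>I. V i) = Pow (Y \<inter> (\<Union>i\<in>I. V i))" by (auto simp: induced_def)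
  moreover have "Y \<inter> (\<Union>i\<in>I. V i) \<noteq> {}"
  proof -
    obtain i where "i \<in> I" "i < Suc n" using assms(2,3) by blast
    then have "Y \<inter> V i \<noteq> {}" using assms(1) unfolding P_iff colorful_def by blast
    with \<open>i \<in> I\<close> show ?thesis by blast
  qed
  moreover have "Y \<subseteq> U" using assms(1) by (auto simp: P_iff)
  ultimately show ?thesis using exact_at_Pow[OF finite_U, of "Y \<inter> (\<Union>i\<in>I. V i)"]
    by (metis le_infI1)
qed

lemma boundary_single_empty_card:
  assumes "s \<in> \<Delta>" "card s = Suc (Suc k)" shows "boundary P (single s) {} = (0 :: 'r)"
proof (rule ccontr)
  assume "boundary P (single s) {} \<noteq> (0 :: 'r)"
  then have "card s = Suc (card ({} :: 'a set set))"
    by (rule boundary_single_nonzeroD(2)) (rule finite_\<Delta>_simplex[OF assms(1)])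
  with assms(2) show False by simp
qed

text \<open>An acyclic carrier argument with carrier \<open>Pow (\<Union>s)\<close>. If
  \<open>s\<close> has one member, \<open>aug_onto\<close> supplies an image of augmentation 1.
  Otherwise the image of the boundary of \<open>s\<close> is a relative cycle of augmentation 0
  inside the carrier, and \<open>relative_vanishing\<close> fills it.\<close>

lemma \<phi>_fills:
  assumes "s \<in> \<Delta>" "card s = Suc k"
  shows "fills k s (lin_ext \<Delta> (\<phi> k) (boundary P (single s))) (\<phi> (Suc k) s)"
  using assms
proof (induction k arbitrary: s)
  case 0
  then obtain \<sigma> where \<sigma>: "s = {\<sigma>}" by (auto simp: card_1_singleton_iff)
  with 0(1) have P: "\<sigma> \<in> P" by (auto simp: Col_def)
  then have "\<sigma> \<in> C" "\<sigma> \<subseteq> U" by (auto simp: P_iff)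
  have "\<exists>w :: 'a set \<Rightarrow> 'r. supported_on {\<tau>\<in>induced (Pow \<sigma>) (\<Union>i<Suc n. V i). card \<tau> = Suc n} w
      \<and> \<epsilon> w = 1"
    by (rule aug_onto[OF finite_U _ _ _ disj exact_at_colorful_simplex[OF P]])
      (use \<open>\<sigma> \<subseteq> U\<close> in auto)
  then obtain w :: "'a set \<Rightarrow> 'r" where w: "supported_on {\<tau>\<in>Pow \<sigma>. card \<tau> = Suc n} w" "\<epsilon> w = 1"
    unfolding induced_Pow_cover[OF \<open>\<sigma> \<in> C\<close>] by blast
  have "boundary U w \<tau> = 0" if "colorful V (Suc n) \<tau>" for \<tau>
    by (rule boundary_colorful_card[OF finite_U disj that]) (use supported_onD[OF w(1)] in auto)
  moreover have "boundary P (single s) {} = (1 :: 'r)"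
    unfolding \<sigma> boundary_single_vertex[OF finite_P P] by (simp add: single_def)
  ultimately have "fills 0 s (lin_ext \<Delta> (\<phi> 0) (boundary P (single s))) w"
    using w unfolding fills_def by (auto simp: \<sigma> lin_ext_def elim!: supported_on_mono)
  then show ?case unfolding \<phi>.simps(2)
    by (rule someI[where P = "fills 0 s (lin_ext \<Delta> (\<phi> 0) (boundary P (single s)))"])
next
  case (Suc k)
  let ?d = "boundary P (single s) :: 'a set set \<Rightarrow> 'r"
  let ?f = "lin_ext \<Delta> (\<phi> (Suc k)) ?d"
  have "s \<noteq> {}" using Suc.prems(2) by auto
  then have P: "\<Union>s \<in> P" using Suc.prems(1) by (rule Union_\<Delta>[rotated])
  then have "\<Union>s \<in> C" "\<Union>s \<subseteq> U" by (auto simp: P_iff)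
  have d: "supported_on {t\<in>\<Delta>. card t = Suc k} ?d"
    using Suc.prems by (intro boundary_support_\<Delta> single_support) auto
  have "\<forall>s\<in>\<Delta>. card s = Suc k \<longrightarrow>
      fills k s (lin_ext \<Delta> (\<phi> k) (boundary P (single s))) (\<phi> (Suc k) s)"
    using Suc.IH by blast
  note chain = \<phi>_chain[OF this d]
  have bf: "boundary U ?f \<tau> = 0" if "colorful V (Suc n) \<tau>" for \<tau>
    using chain(2)[OF that] by (simp add: boundary_boundary[OF finite_P] lin_ext_zero)
  have ef: "\<epsilon> ?f = 0" using chain(3) by (simp only: boundary_boundary[OF finite_P])
  have "supported_on {\<sigma>\<in>Pow (\<Union>s). card \<sigma> = Suc (k + n)} ?f"
  proof (rule supported_on_lin_ext)
    fix t assume t: "t \<in> \<Delta>" "?d t \<noteq> 0"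
    have "t \<subseteq> s" using boundary_single_nonzeroD(1)[OF t(2)] finite_\<Delta>_simplex Suc.prems(1) by blast
    moreover have "card t = Suc k" using supported_onD[OF d t(2)] by auto
    ultimately show "supported_on {\<sigma>\<in>Pow (\<Union>s). card \<sigma> = Suc (k + n)} (\<phi> (Suc k) t)"
      using Suc.IH[OF t(1)] Union_mono[OF \<open>t \<subseteq> s\<close>] unfolding fills_def
      by (blast intro: supported_on_mono)
  qed
  then have sf: "supported_on {\<sigma>\<in>induced (Pow (\<Union>s)) (\<Union>i<Suc n. V i). card \<sigma> = Suc (k + n)} ?f"
    by (simp only: induced_Pow_cover[OF \<open>\<Union>s \<in> C\<close>])
  have "\<exists>w. supported_on {\<sigma>\<in>induced (Pow (\<Union>s)) (\<Union>i<Suc n. V i). card \<sigma> = Suc (Suc (k + n))} w \<and>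
      (\<forall>\<tau>. colorful V (Suc n) \<tau> \<longrightarrow> ?f \<tau> = boundary U w \<tau>)"
  proof (rule relative_vanishing[OF finite_U _ _ disj subset_refl _ sf])
    fix S assume "S \<subseteq> {..<Suc n}" "{..<Suc n} - S \<noteq> {}"
    then show "exact_at R U (induced (Pow (\<Union>s)) (\<Union>i\<in>{..<Suc n} - S. V i)) (Suc (k + n) - card S)"
      by (intro exact_at_colorful_simplex[OF P]) auto
  qed (use bf ef \<open>\<Union>s \<subseteq> U\<close> in auto)
  then obtain w where w: "supported_on {\<sigma>\<in>Pow (\<Union>s). card \<sigma> = Suc (Suc (k + n))} w"
      "\<And>\<tau>. colorful V (Suc n) \<tau> \<Longrightarrow> ?f \<tau> = boundary U w \<tau>"
    unfolding induced_Pow_cover[OF \<open>\<Union>s \<in> C\<close>] by blast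
  \<comment> \<open>\<open>w\<close> lives above cardinality \<open>Suc n\<close>, the only one that
    \<open>\<epsilon>\<close> sees. This agrees with the boundary of \<open>s\<close>, which has
    coefficient 0 at the empty chain because \<open>s\<close> has at least two members.\<close>
  have "\<epsilon> w = 0"
    by (rule aug_card[OF finite_U]) (use supported_onD[OF w(1)] in force)
  then have "fills (Suc k) s ?f w"
    using w boundary_single_empty_card[OF Suc.prems] unfolding fills_def
    by (auto elim!: supported_on_mono)
  then show ?case unfolding \<phi>.simps(2)[of "Suc k"]
    by (rule someI[where P = "fills (Suc k) s ?f"])
qed

section \<open>The homotopy from the identity to the composition\<close>

primrec htpy :: "nat \<Rightarrow> 'a set set \<Rightarrow> 'a set set \<Rightarrow> 'r" where
  "htpy 0 s = (\<lambda>_. 0)"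
| "htpy (Suc k) s = cone (\<Union>s) (\<lambda>t. single s t - lin_ext P (sd (Suc (k + n))) (\<phi> (Suc k) s) t
     - lin_ext \<Delta> (htpy k) (boundary P (single s)) t)"

lemma htpy_support_aux:
  assumes IH: "\<And>t. t \<in> \<Delta> \<Longrightarrow> card t = k \<Longrightarrow>
      supported_on {u\<in>\<Delta>. (\<forall>\<tau>\<in>u. \<tau> \<subseteq> \<Union>t) \<and> card u + 0 = Suc k} (htpy k t)"
    and s: "s \<in> \<Delta>" "card s = Suc k"
  shows "supported_on {u\<in>\<Delta>. (\<forall>\<tau>\<in>u. \<tau> \<subseteq> \<Union>s) \<and> card u + 0 = Suc k}
    (\<lambda>t. single s t - lin_ext P (sd (Suc (k + n))) (\<phi> (Suc k) s) t
     - lin_ext \<Delta> (htpy k) (boundary P (single s)) t)"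
proof (intro supported_on_diff)
  show "supported_on {u\<in>\<Delta>. (\<forall>\<tau>\<in>u. \<tau> \<subseteq> \<Union>s) \<and> card u + 0 = Suc k} (single s)"
    using s by (intro single_support) auto
  show "supported_on {u\<in>\<Delta>. (\<forall>\<tau>\<in>u. \<tau> \<subseteq> \<Union>s) \<and> card u + 0 = Suc k}
      (lin_ext P (sd (Suc (k + n))) (\<phi> (Suc k) s))"
  proof (rule supported_on_lin_ext)
    fix \<sigma> assume \<sigma>: "\<sigma> \<in> P" "\<phi> (Suc k) s \<sigma> \<noteq> 0"
    then have "\<sigma> \<subseteq> \<Union>s" "card \<sigma> = Suc (k + n)"
      using \<phi>_fills[OF s] supported_onD[of _ "\<phi> (Suc k) s" \<sigma>] unfolding fills_def by blast+
    then show "supported_on {u\<in>\<Delta>. (\<forall>\<tau>\<in>u. \<tau> \<subseteq> \<Union>s) \<and> card u + 0 = Suc k} (sd (Suc (k + n)) \<sigma>)"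
      by (intro supported_on_mono[OF sd_support[OF \<sigma>(1)]]) auto
  qed
  show "supported_on {u\<in>\<Delta>. (\<forall>\<tau>\<in>u. \<tau> \<subseteq> \<Union>s) \<and> card u + 0 = Suc k}
      (lin_ext \<Delta> (htpy k) (boundary P (single s)))"
  proof (rule supported_on_lin_ext)
    fix t assume t: "t \<in> \<Delta>" "boundary P (single s) t \<noteq> (0 :: 'r)"
    have "t \<subseteq> s" "card t = k"
      using boundary_single_nonzeroD[OF t(2) finite_\<Delta>_simplex[OF s(1)]] s(2) by auto
    then show "supported_on {u\<in>\<Delta>. (\<forall>\<tau>\<in>u. \<tau> \<subseteq> \<Union>s) \<and> card u + 0 = Suc k} (htpy k t)"
      using Union_mono[OF \<open>t \<subseteq> s\<close>] by (intro supported_on_mono[OF IH[OF t(1)]]) blast+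
  qed
qed

lemma htpy_support:
  assumes "s \<in> \<Delta>" "card s = k"
  shows "supported_on {u\<in>\<Delta>. (\<forall>\<tau>\<in>u. \<tau> \<subseteq> \<Union>s) \<and> card u + 0 = Suc k} (htpy k s)"
  using assms
proof (induction k arbitrary: s)
  case 0
  then show ?case by (simp add: supported_on_def)
next
  case (Suc k)
  have "\<Union>s \<in> P" using Suc.prems by (intro Union_\<Delta>) auto
  moreover have "supported_on {u\<in>\<Delta>. (\<forall>\<tau>\<in>u. \<tau> \<subseteq> \<Union>s) \<and> card u + 0 = Suc k}
    (\<lambda>t. single s t - lin_ext P (sd (Suc (k + n))) (\<phi> (Suc k) s) t
     - lin_ext \<Delta> (htpy k) (boundary P (single s)) t)"
    by (rule htpy_support_aux[OF _ Suc.prems]) (rule Suc.IH)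
  ultimately show ?case unfolding htpy.simps by (intro cone_support)
qed

lemma htpy_cone_base_support:
  assumes "s \<in> \<Delta>" "card s = Suc k"
  shows "supported_on {u\<in>\<Delta>. (\<forall>\<tau>\<in>u. \<tau> \<subseteq> \<Union>s) \<and> card u + 0 = Suc k}
    (\<lambda>t. single s t - lin_ext P (sd (Suc (k + n))) (\<phi> (Suc k) s) t
     - lin_ext \<Delta> (htpy k) (boundary P (single s)) t)"
  by (rule htpy_support_aux[OF _ assms]) (rule htpy_support)

lemma boundary_htpy_lin_ext:
  assumes bd: "\<And>s. s \<in> \<Delta> \<Longrightarrow> card s = Suc k \<Longrightarrow> boundary P (htpy (Suc k) s) =
      (\<lambda>t. single s t - lin_ext P (sd (Suc (k + n))) (\<phi> (Suc k) s) t
        - lin_ext \<Delta> (htpy k) (boundary P (single s)) t)"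
    and c: "supported_on {s\<in>\<Delta>. card s = Suc k} c"
  shows "boundary P (lin_ext \<Delta> (htpy (Suc k)) c) =
      (\<lambda>t. c t - lin_ext P (sd (Suc (k + n))) (lin_ext \<Delta> (\<phi> (Suc k)) c) t
        - lin_ext \<Delta> (htpy k) (boundary P c) t)"
proof
  fix t
  have c': "supported_on \<Delta> c" by (rule supported_on_mono[OF c]) auto
  have "boundary P (lin_ext \<Delta> (htpy (Suc k)) c) t =
      lin_ext \<Delta> (\<lambda>s t. single s t - lin_ext P (sd (Suc (k + n))) (\<phi> (Suc k) s) t
        - lin_ext \<Delta> (htpy k) (boundary P (single s)) t) c t"
    unfolding boundary_lin_ext
    by (rule lin_ext_cong) (use bd supported_onD[OF c] in auto)
  also have "\<dots> = lin_ext \<Delta> single c t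
      - lin_ext \<Delta> (\<lambda>s. lin_ext P (sd (Suc (k + n))) (\<phi> (Suc k) s)) c t
      - lin_ext \<Delta> (\<lambda>s. lin_ext \<Delta> (htpy k) (boundary P (single s))) c t"
    unfolding lin_ext_def[of \<Delta> _ c] by (simp only: right_diff_distrib sum_subtractf)
  finally show "boundary P (lin_ext \<Delta> (htpy (Suc k)) c) t =
      c t - lin_ext P (sd (Suc (k + n))) (lin_ext \<Delta> (\<phi> (Suc k)) c) t
        - lin_ext \<Delta> (htpy k) (boundary P c) t"
    by (simp only: lin_ext_by_singles[OF finite_\<Delta> c'] lin_ext_boundary[OF finite_\<Delta> c', of \<Delta> "htpy k"]
        lin_ext_lin_ext[of P _ \<Delta>])
qed

text \<open>The sum over \<open>P\<close> reads only colorful coefficients, so the relative equation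
  for \<open>\<phi>\<close> suffices to compose the two maps. The term at the empty chain is
  separate because \<open>\<phi> 0\<close> is zero.\<close>

lemma boundary_sd_\<phi>:
  assumes "s \<in> \<Delta>" "card s = Suc k"
  shows "boundary P (lin_ext P (sd (Suc (k + n))) (\<phi> (Suc k) s)) =
    (\<lambda>t. lin_ext P (sd (k + n)) (lin_ext \<Delta> (\<phi> k) (boundary P (single s))) t
       + boundary P (single s) {} * single {} t)"
proof -
  have "s \<noteq> {}" using assms(2) by auto
  note f = \<phi>_fills[OF assms]
  have "boundary P (lin_ext P (sd (Suc (k + n))) (\<phi> (Suc k) s)) =
      (\<lambda>t. lin_ext P (sd (k + n)) (boundary U (\<phi> (Suc k) s)) t + \<epsilon> (\<phi> (Suc k) s) * single {} t)"
    by (rule boundary_sd_chain[OF fills_support[OF f assms(1) \<open>s \<noteq> {}\<close>]])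
  moreover have "lin_ext P (sd (k + n)) (boundary U (\<phi> (Suc k) s)) =
      lin_ext P (sd (k + n)) (lin_ext \<Delta> (\<phi> k) (boundary P (single s)))"
    unfolding lin_ext_def[of P]
  proof (intro ext sum.cong refl)
    fix t \<sigma> assume "\<sigma> \<in> P"
    then have "boundary U (\<phi> (Suc k) s) \<sigma> = lin_ext \<Delta> (\<phi> k) (boundary P (single s)) \<sigma>"
      using f unfolding fills_def P_iff by blast
    then show "boundary U (\<phi> (Suc k) s) \<sigma> * sd (k + n) \<sigma> t =
        lin_ext \<Delta> (\<phi> k) (boundary P (single s)) \<sigma> * sd (k + n) \<sigma> t" by (simp only:)
  qed
  moreover have "\<epsilon> (\<phi> (Suc k) s) = boundary P (single s) {}"
    using f unfolding fills_def by blast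
  ultimately show ?thesis by (simp only:)
qed

text \<open>Again the base of the cone has to be a cycle. If \<open>s\<close> has one member, its
  boundary is the empty chain and cancels the augmentation term; otherwise the formula one
  cardinality lower, applied to the boundary of \<open>s\<close>, cancels all terms.\<close>

lemma boundary_htpy:
  assumes "s \<in> \<Delta>" "card s = Suc k"
  shows "boundary P (htpy (Suc k) s) =
      (\<lambda>t. single s t - lin_ext P (sd (Suc (k + n))) (\<phi> (Suc k) s) t
        - lin_ext \<Delta> (htpy k) (boundary P (single s)) t)"
  using assms
proof (induction k arbitrary: s)
  case 0
  then obtain \<sigma> where \<sigma>: "s = {\<sigma>}" by (auto simp: card_1_singleton_iff)
  with 0(1) have "\<sigma> \<in> P" by (auto simp: Col_def)
  then have bs: "boundary P (single s) = (single {} :: _ \<Rightarrow> 'r)"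
    unfolding \<sigma> by (rule boundary_single_vertex[OF finite_P])
  have "lin_ext \<Delta> (htpy 0) c = (\<lambda>_. 0)" "lin_ext \<Delta> (\<phi> 0) c = (\<lambda>_. 0)" for c
    by (simp_all add: lin_ext_def)
  then have "boundary P (\<lambda>t. single s t - lin_ext P (sd (Suc (0 + n))) (\<phi> (Suc 0) s) t
        - lin_ext \<Delta> (htpy 0) (boundary P (single s)) t) = (\<lambda>_. 0)"
    unfolding boundary_diff boundary_sd_\<phi>[OF 0] bs
    by (simp only: boundary_zero lin_ext_zero) (simp add: single_def fun_eq_iff)
  moreover have "\<Union>s \<in> P" using 0 by (intro Union_\<Delta>) auto
  moreover note htpy_cone_base_support[OF 0]
  ultimately show ?case unfolding htpy.simps(2)
    by (intro boundary_cone_cycle)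
next
  case (Suc k)
  let ?d = "boundary P (single s) :: 'a set set \<Rightarrow> 'r"
  have d: "supported_on {t\<in>\<Delta>. card t = Suc k} ?d"
    using Suc.prems by (intro boundary_support_\<Delta> single_support) auto
  have chain: "boundary P (lin_ext \<Delta> (htpy (Suc k)) ?d) =
      (\<lambda>t. ?d t - lin_ext P (sd (Suc (k + n))) (lin_ext \<Delta> (\<phi> (Suc k)) ?d) t
        - lin_ext \<Delta> (htpy k) (boundary P ?d) t)"
    by (rule boundary_htpy_lin_ext[OF _ d]) (rule Suc.IH)
  have "boundary P (\<lambda>t. single s t - lin_ext P (sd (Suc (Suc k + n))) (\<phi> (Suc (Suc k)) s) t
        - lin_ext \<Delta> (htpy (Suc k)) ?d t) = (\<lambda>_. 0)"
    unfolding boundary_diff boundary_sd_\<phi>[OF Suc.prems] chain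
      boundary_boundary[OF finite_P] boundary_single_empty_card[OF Suc.prems] lin_ext_zero
    by (simp only: add_Suc) simp
  moreover have "\<Union>s \<in> P" using Suc.prems by (intro Union_\<Delta>) auto
  moreover note htpy_cone_base_support[OF Suc.prems]
  ultimately show ?case unfolding htpy.simps(2)[of "Suc k"]
    by (intro boundary_cone_cycle)
qed

lemma boundary_htpy_chain:
  assumes "supported_on {s\<in>\<Delta>. card s = Suc k} c"
  shows "boundary P (lin_ext \<Delta> (htpy (Suc k)) c) =
      (\<lambda>t. c t - lin_ext P (sd (Suc (k + n))) (lin_ext \<Delta> (\<phi> (Suc k)) c) t
        - lin_ext \<Delta> (htpy k) (boundary P c) t)"
  by (rule boundary_htpy_lin_ext[OF _ assms]) (rule boundary_htpy)

section \<open>Vanishing of the homology of the colorful complex\<close>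

lemma sd_chain_support:
  assumes "supported_on {\<sigma>\<in>C. card \<sigma> = k + n} c"
  shows "supported_on {s\<in>\<Delta>. card s = k} (lin_ext P (sd (k + n)) c)"
proof (rule supported_on_lin_ext)
  fix \<sigma> assume "\<sigma> \<in> P" "c \<sigma> \<noteq> 0"
  then show "supported_on {s\<in>\<Delta>. card s = k} (sd (k + n) \<sigma>)"
    using supported_onD[OF assms] by (intro supported_on_mono[OF sd_support[of \<sigma> "k + n"]]) auto
qed

lemma induced_cover: "induced C (\<Union>i<Suc n. V i) = C"
  unfolding induced_def cover[symmetric] by auto

theorem exact_at_Col:
  assumes ex: "\<And>I. I \<noteq> {} \<Longrightarrow> I \<subseteq> {..<Suc n} \<Longrightarrow>
    exact_at R U (induced C (\<Union>i\<in>I. V i)) (card I + m - 1)"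
  shows "exact_at R P \<Delta> m"
  unfolding exact_at_def
proof (intro allI impI)
  fix z :: "'a set set \<Rightarrow> 'r"
  assume z: "supported_on {s\<in>\<Delta>. card s = m} z" and cyc: "boundary P z = (\<lambda>_. 0)"
  show "\<exists>d. supported_on {s\<in>\<Delta>. card s = Suc m} d \<and> boundary P d = z"
  proof (cases m)
    case 0
    \<comment> \<open>Cycles of cardinality 0 are multiples of the empty chain, and subdividing a
      chain of augmentation 1 exhibits the empty chain as a boundary.\<close>
    have "\<exists>w :: 'a set \<Rightarrow> 'r. supported_on {\<sigma>\<in>induced C (\<Union>i<Suc n. V i). card \<sigma> = Suc n} w \<and> \<epsilon> w = 1"
      using ex 0 by (intro aug_onto[OF finite_U C_sub empty_in _ disj]) (auto intro: face_in)
    then obtain w :: "'a set \<Rightarrow> 'r" where w: "supported_on {\<sigma>\<in>C. card \<sigma> = Suc n} w" "\<epsilon> w = 1"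
      unfolding induced_cover by blast
    have "boundary U w \<sigma> = 0" if "\<sigma> \<in> P" for \<sigma>
      using that supported_onD[OF w(1)]
      by (intro boundary_colorful_card[OF finite_U disj]) (auto simp: P_iff)
    then have "lin_ext P (sd n) (boundary U w) = (\<lambda>_. 0)" by (simp add: lin_ext_def)
    then have bd: "boundary P (lin_ext P (sd (Suc n)) w) = single {}"
      using boundary_sd_chain[OF w(1)] w(2) by simp
    have zs: "z s = z {} * single {} s" for s
    proof (cases "s = {}")
      case False
      have "z s = 0"
        using supported_onD[OF z, of s] 0 False finite_\<Delta>_simplex[of s] by auto
      with False show ?thesis by (simp add: single_def)
    qed (simp add: single_def)
    have "supported_on {s\<in>\<Delta>. card s = Suc 0} (lin_ext P (sd (Suc n)) w)"
      using sd_chain_support[of "Suc 0" w] w(1) by simp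
    then have "supported_on {s\<in>\<Delta>. card s = Suc m} (\<lambda>s. z {} * lin_ext P (sd (Suc n)) w s)"
      using 0 by (simp add: supported_on_def)
    moreover have "boundary P (\<lambda>s. z {} * lin_ext P (sd (Suc n)) w s) = z"
      unfolding boundary_scale bd by (rule ext) (rule zs[symmetric])
    ultimately show ?thesis by blast
  next
    case (Suc k)
    have z': "supported_on {s\<in>\<Delta>. card s = Suc k} z" using z Suc by simp
    let ?c = "lin_ext \<Delta> (\<phi> (Suc k)) z"
    have "\<forall>s\<in>\<Delta>. card s = Suc k \<longrightarrow>
        fills k s (lin_ext \<Delta> (\<phi> k) (boundary P (single s))) (\<phi> (Suc k) s)"
      using \<phi>_fills by blast
    note chain = \<phi>_chain[OF this z']
    have "\<exists>w. supported_on {\<sigma>\<in>induced C (\<Union>i<Suc n. V i). card \<sigma> = Suc (Suc (k + n))} w \<and>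
        (\<forall>\<tau>. colorful V (Suc n) \<tau> \<longrightarrow> ?c \<tau> = boundary U w \<tau>)"
    proof (rule relative_vanishing[OF finite_U C_sub _ disj subset_refl])
      show "supported_on {\<sigma>\<in>induced C (\<Union>i<Suc n. V i). card \<sigma> = Suc (k + n)} ?c"
        unfolding induced_cover by (rule chain(1))
      show "\<sigma> - {v} \<in> C" if "\<sigma> \<in> C" for \<sigma> v using that face_in by blast
      show "boundary U ?c \<tau> = 0" if "colorful V (Suc n) \<tau>" for \<tau>
        using chain(2)[OF that] by (simp add: cyc lin_ext_zero)
      show "\<epsilon> ?c = 0" using chain(3) cyc by simp
    next
      fix S assume S: "S \<subseteq> {..<Suc n}" "{..<Suc n} - S \<noteq> {}"
      have "card ({..<Suc n} - S) = Suc n - card S"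
        using S(1) by (subst card_Diff_subset) (auto intro: finite_subset)
      moreover have "card ({..<Suc n} - S) > 0" using S(2) by (simp add: card_gt_0_iff)
      \<comment> \<open>With \<open>I\<close> the complement of \<open>S\<close>, the cardinality in
        the assumption is the one that \<open>relative_vanishing\<close> asks for.\<close>
      ultimately have "card ({..<Suc n} - S) + m - 1 = Suc (k + n) - card S" using Suc by simp
      then show "exact_at R U (induced C (\<Union>i\<in>{..<Suc n} - S. V i)) (Suc (k + n) - card S)"
        using ex[OF S(2)] by simp
    qed
    then obtain w where w: "supported_on {\<sigma>\<in>C. card \<sigma> = Suc (Suc (k + n))} w"
      "\<And>\<tau>. colorful V (Suc n) \<tau> \<Longrightarrow> ?c \<tau> = boundary U w \<tau>"
      unfolding induced_cover by blast
    have "\<epsilon> w = 0" by (rule aug_card[OF finite_U]) (use supported_onD[OF w(1)] in force)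
    then have "boundary P (lin_ext P (sd (Suc (Suc (k + n)))) w) =
        lin_ext P (sd (Suc (k + n))) (boundary U w)"
      using boundary_sd_chain[OF w(1)] by simp
    also have "\<dots> = lin_ext P (sd (Suc (k + n))) ?c"
      unfolding lin_ext_def[of P] using w(2) by (intro ext sum.cong) (auto simp: P_iff)
    finally have bd: "boundary P (lin_ext P (sd (Suc (Suc (k + n)))) w) =
        lin_ext P (sd (Suc (k + n))) ?c" .
    \<comment> \<open>The homotopy bounds \<open>z\<close> minus the subdivided image of
      \<open>z\<close>, and the subdivision of \<open>w\<close> bounds that image.\<close>
    let ?d = "\<lambda>t. lin_ext \<Delta> (htpy (Suc k)) z t + lin_ext P (sd (Suc (Suc (k + n)))) w t"
    have "supported_on {s\<in>\<Delta>. card s = Suc (Suc k)} ?d"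
    proof (rule supported_on_add)
      show "supported_on {s\<in>\<Delta>. card s = Suc (Suc k)} (lin_ext P (sd (Suc (Suc (k + n)))) w)"
        using sd_chain_support[of "Suc (Suc k)" w] w(1) by simp
      show "supported_on {s\<in>\<Delta>. card s = Suc (Suc k)} (lin_ext \<Delta> (htpy (Suc k)) z)"
      proof (rule supported_on_lin_ext)
        fix s assume "s \<in> \<Delta>" "z s \<noteq> 0"
        then show "supported_on {s\<in>\<Delta>. card s = Suc (Suc k)} (htpy (Suc k) s)"
          using supported_onD[OF z'] by (intro supported_on_mono[OF htpy_support[of s "Suc k"]]) auto
      qed
    qed
    moreover have "boundary P ?d = z"
      unfolding boundary_add boundary_htpy_chain[OF z'] bd cyc lin_ext_zero by simp
    ultimately show ?thesis using Suc by blast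
  qed
qed

end

theorem theorem4p1:
  fixes R :: "'r::comm_ring_1 itself"
    and C :: "'a set set" and V :: "nat \<Rightarrow> 'a set" and n m :: nat
  assumes "simplicial_complex C" and "finite C"
    and "\<forall>i\<le>n. V i \<noteq> {}"
    and "\<forall>i\<le>n. \<forall>j\<le>n. i \<noteq> j \<longrightarrow> V i \<inter> V j = {}"
    and "(\<Union>i\<le>n. V i) = vertices C"
    and "\<forall>I. I \<noteq> {} \<and> I \<subseteq> {0..n} \<longrightarrow>
           reduced_homology_vanishes R (induced C (\<Union>i\<in>I. V i)) (int (card I) + int m - 2)"
  shows "reduced_homology_vanishes R (Col C V n) (int m - 1)"
proof -
  \<comment> \<open>A nonempty class yields a simplex of \<open>C\<close>, hence the empty simplex,
    which the locale requires.\<close>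
  have "vertices C \<noteq> {}" using assms(3,5) by blast
  then obtain \<sigma> where "\<sigma> \<in> C" unfolding vertices_def by blast
  then have "{} \<in> C" using assms(1) unfolding simplicial_complex_def by blast
  interpret colored_complex R C V n
  proof
    show "disjoint_family_on V {..<Suc n}" using assms(4) by (auto simp: disjoint_family_on_def)
    show "\<Union>C = (\<Union>i<Suc n. V i)" using assms(5) by (simp add: vertices_def lessThan_Suc_atMost)
  qed fact+
  have "exact_at R P \<Delta> m"
  proof (rule exact_at_Col)
    fix I assume I: "I \<noteq> {}" "I \<subseteq> {..<Suc n}"
    then have "card I > 0" by (auto simp: card_gt_0_iff intro: finite_subset)
    \<comment> \<open>Cardinalities exceed degrees by one. Since \<open>card I\<close> is positive,
      the truncated subtraction is harmless, also for \<open>m = 0\<close>.\<close>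
    then have eq: "int (card I) + int m - 2 = int (card I + m - 1) - 1" by simp
    have "reduced_homology_vanishes R (induced C (\<Union>i\<in>I. V i)) (int (card I + m - 1) - 1)"
      using assms(6) I unfolding eq[symmetric] by (auto simp: lessThan_Suc_atMost atLeast0AtMost)
    then show "exact_at R U (induced C (\<Union>i\<in>I. V i)) (card I + m - 1)"
      by (subst (asm) reduced_homology_vanishes_iff_exact_at[OF finite_U])
        (use empty_in face_in in \<open>auto simp: induced_def\<close>)
  qed
  then show ?thesis
    by (subst reduced_homology_vanishes_iff_exact_at[OF finite_P \<Delta>_sub empty_\<Delta>])
      (use \<Delta>_face in auto)
qed

end
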